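(* Let $(W,S)$ be a Coxeter system of type $D_n$, $n\ge3$. As a $\mathbb{Q}$-algebra, $\mathfrak{E}(W)=\mathbb{Q}[x_{n-1}]$ is isomorphic to $\mathbb{Q}[x]/(x^{\underline{n}}-x^{\underline{n-1}})$, via an isomorphism sending $x_{n-1}$ to the coset of $2x^{\underline{1}}$. Its $\mathbb{Q}$-bases $\{x_1,\dots,x_n\}$ and $\{x_{n-1}^0,\dots,x_{n-1}^{n-1}\}$ are related by the base change formulas $$x_{n-k}=\sum_{m=0}^{k}(-2)^{k-m}\genfrac{[}{]}{0pt}{}{k}{m}\,x_{n-1}^m\quad\text{and}\quad x_{n-1}^k=\sum_{m=0}^{k}\genfrac{\{}{\}}{0pt}{}{k}{m}\,2^{k-m}\,x_{n-m},$$ for $0\le k\le n-1$.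
   Context: For a finite Coxeter system $(W,S)$ with length function $\ell$ and $J\subseteq S$, let $X_J=\{w\in W: \ell(ws)>\ell(w)\text{ for all } s\in J\}$ and $x_J=\sum_{w\in X_J} w$ in the group algebra $\mathbb{Q}W$. For type $D_n$ label $S=\{s_1,\dots,s_n\}$ so that $s_1s_3$, $s_2s_3$ and $s_is_{i+1}$ for $3\le i\le n-1$ have order $3$, and all other pairs of distinct generators commute. Put $x_j=x_{\{s_1,\dots,s_j\}}$ for $2\le j\le n$ (so $x_n=1$), and $x_1=x_\emptyset=\sum_{w\in W}w$ (not $x_{\{s_1\}}$). $\mathfrak{E}(W)=\mathbb{Q}[x_{n-1}]$ is the unital subalgebra of $\mathbb{Q}W$ generated by $x_{n-1}$. The falling power is $x^{\underline{k}}=\prod_{i=0}^{k-1}(x-i)$, so $x^{\underline{1}}=x$. $\genfrac{[}{]}{0pt}{}{k}{m}$ is the (unsigned) Stirling number of the first kind (number of ways to arrange $k$ elements in $m$ cycles), and $\genfrac{\{}{\}}{0pt}{}{k}{m}$ is the Stirling number of the second kind (number of partitions of a $k$-element set into $m$ nonempty subsets). *)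

theory Defs
  imports
    "HOL-Algebra.Algebra"
    "HOL-Algebra.Algebraic_Closure_Type"
    "HOL-Combinatorics.Stirling"
    "HOL-Computational_Algebra.Polynomial"
begin

section \<open>Coxeter systems\<close>

definition word_prod :: "('w, 'm) monoid_scheme \<Rightarrow> 'w list \<Rightarrow> 'w" where
  "word_prod W us = foldr (\<otimes>\<^bsub>W\<^esub>) us \<one>\<^bsub>W\<^esub>"

text \<open>One application of a defining relation \<open>(s t)^m(s,t) = 1\<close> to a word in the generators, where
  \<open>m(s,t)\<close> is the order of \<open>s t\<close> in \<open>W\<close>. For \<open>s = t\<close> this deletes \<open>s s\<close>. HOL-Algebra gives an
  element of infinite order the order \<open>0\<close>; the step is then trivial, as it should be.\<close>

definition coxeter_step :: "('w, 'm) monoid_scheme \<Rightarrow> 'w set \<Rightarrow> 'w list \<Rightarrow> 'w list \<Rightarrow> bool" where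
  "coxeter_step W S us vs \<longleftrightarrow>
     (\<exists>a\<in>lists S. \<exists>b\<in>lists S. \<exists>s\<in>S. \<exists>t\<in>S.
        us = a @ concat (replicate (group.ord W (s \<otimes>\<^bsub>W\<^esub> t)) [s, t]) @ b \<and> vs = a @ b)"

text \<open>The last conjunct says that \<open>W\<close> is presented by \<open>S\<close> and the relations \<open>(s t)^m(s,t) = 1\<close>.
  As the generators are involutions and the words \<open>s s\<close> are among the relators, no formal inverses
  are needed: the monoid with this presentation is the group with this presentation.\<close>

definition coxeter_system :: "('w, 'm) monoid_scheme \<Rightarrow> 'w set \<Rightarrow> bool" where
  "coxeter_system W S \<longleftrightarrow>
     group W \<and> S \<subseteq> carrier W \<and> generate W S = carrier W \<and>
     (\<forall>s\<in>S. group.ord W s = 2) \<and>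
     (\<forall>us\<in>lists S. word_prod W us = \<one>\<^bsub>W\<^esub> \<longrightarrow> equivclp (coxeter_step W S) us [])"

definition coxeter_length :: "('w, 'm) monoid_scheme \<Rightarrow> 'w set \<Rightarrow> 'w \<Rightarrow> nat" where
  "coxeter_length W S w = (LEAST k. \<exists>us\<in>lists S. length us = k \<and> word_prod W us = w)"

definition coset_reps :: "('w, 'm) monoid_scheme \<Rightarrow> 'w set \<Rightarrow> 'w set \<Rightarrow> 'w set" where
  "coset_reps W S J =
     {w \<in> carrier W. \<forall>s\<in>J. coxeter_length W S (w \<otimes>\<^bsub>W\<^esub> s) > coxeter_length W S w}"

definition type_D_edge :: "nat \<Rightarrow> nat \<Rightarrow> nat \<Rightarrow> bool" where
  "type_D_edge n i j \<longleftrightarrow>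
     (i = 1 \<and> j = 3) \<or> (i = 2 \<and> j = 3) \<or> (3 \<le> i \<and> i \<le> n - 1 \<and> j = i + 1)"

definition coxeter_system_type_D ::
    "('w, 'm) monoid_scheme \<Rightarrow> 'w set \<Rightarrow> (nat \<Rightarrow> 'w) \<Rightarrow> nat \<Rightarrow> bool" where
  "coxeter_system_type_D W S s n \<longleftrightarrow>
     coxeter_system W S \<and> bij_betw s {1..n} S \<and>
     (\<forall>i\<in>{1..n}. \<forall>j\<in>{1..n}. i < j \<longrightarrow>
        (if type_D_edge n i j then group.ord W (s i \<otimes>\<^bsub>W\<^esub> s j) = 3
         else s i \<otimes>\<^bsub>W\<^esub> s j = s j \<otimes>\<^bsub>W\<^esub> s i))"


section \<open>Rational algebras\<close>

text \<open>A \<open>\<rat>\<close>-algebra is rendered as a module record over the type \<open>rat\<close>: a (not necessarily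
  commutative) ring structure together with a scalar multiplication.\<close>

definition generated_subalgebra :: "(rat, 'a) module \<Rightarrow> 'a set \<Rightarrow> (rat, 'a) module" where
  "generated_subalgebra A T =
     A\<lparr>carrier := \<Inter>{V. subring V A \<and> (\<forall>c. \<forall>v\<in>V. c \<odot>\<^bsub>A\<^esub> v \<in> V) \<and> T \<subseteq> V}\<rparr>"

definition quotient_algebra :: "(rat, 'a) module \<Rightarrow> 'a set \<Rightarrow> (rat, 'a set) module" where
  "quotient_algebra A I =
     ring.extend (A Quot I) (module.fields
      (\<lambda>c C. \<Union>a\<in>C. I +>\<^bsub>A\<^esub> (c \<odot>\<^bsub>A\<^esub> a)))"

definition algebra_iso :: "(rat, 'a) module \<Rightarrow> (rat, 'b) module \<Rightarrow> ('a \<Rightarrow> 'b) set" where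
  "algebra_iso A B =
     {h \<in> ring_iso A B. \<forall>c. \<forall>a\<in>carrier A. h (c \<odot>\<^bsub>A\<^esub> a) = c \<odot>\<^bsub>B\<^esub> h a}"

text \<open>The library's \<open>ring.independent\<close> and \<open>ring.Span\<close> take their scalars from a subfield of the
  ring; here this is the copy \<open>\<rat> 1\<close> of the rationals inside \<open>A\<close>. A list with repetitions is
  dependent, so a basis list enumerates its elements without repetition.\<close>

definition scalars :: "(rat, 'a) module \<Rightarrow> 'a set" where
  "scalars A = range (\<lambda>c. c \<odot>\<^bsub>A\<^esub> \<one>\<^bsub>A\<^esub>)"

definition basis_in :: "(rat, 'a) module \<Rightarrow> 'a set \<Rightarrow> 'a list \<Rightarrow> bool" where
  "basis_in A V us \<longleftrightarrow>
     ring.independent A (scalars A) us \<and> ring.Span A (scalars A) us = V"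

definition poly_algebra :: "(rat, rat poly) module" where
  "poly_algebra =
     ring.extend ring_of_type_algebra (module.fields Polynomial.smult)"

definition falling_power :: "'a::comm_ring_1 \<Rightarrow> nat \<Rightarrow> 'a" where
  "falling_power x k = (\<Prod>i<k. x - of_nat i)"

text \<open>Elements of the group algebra are finitely supported functions \<open>W \<rightarrow> \<rat>\<close>, extended by \<open>0\<close>
  outside the carrier; the product is convolution.\<close>

definition group_algebra :: "('w, 'm) monoid_scheme \<Rightarrow> (rat, 'w \<Rightarrow> rat) module" where
  "group_algebra W =
     \<lparr>carrier = {f. finite {w. f w \<noteq> 0} \<and> {w. f w \<noteq> 0} \<subseteq> carrier W},
      monoid.mult = (\<lambda>f g w. \<Sum>u | f u \<noteq> 0. \<Sum>v | g v \<noteq> 0 \<and> u \<otimes>\<^bsub>W\<^esub> v = w. f u * g v),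
      monoid.one = (\<lambda>w. if w = \<one>\<^bsub>W\<^esub> then 1 else 0),
      ring.zero = (\<lambda>w. 0),
      ring.add = (\<lambda>f g w. f w + g w),
      module.smult = (\<lambda>c f w. c * f w)\<rparr>"

definition group_elem :: "'w \<Rightarrow> 'w \<Rightarrow> rat" where
  "group_elem w = (\<lambda>v. if v = w then 1 else 0)"


section \<open>The elements \<open>x\<^sub>j\<close> and the algebra they span in type D\<close>

definition x_set :: "('w, 'm) monoid_scheme \<Rightarrow> 'w set \<Rightarrow> 'w set \<Rightarrow> ('w \<Rightarrow> rat)" where
  "x_set W S J = (\<Oplus>\<^bsub>group_algebra W\<^esub>w\<in>coset_reps W S J. group_elem w)"

text \<open>By convention \<open>x\<^sub>1\<close> is \<open>x_\<emptyset>\<close>, the sum of all group elements, and not the element \<open>x_{s\<^sub>1}\<close>.\<close>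

definition x_elem ::
    "('w, 'm) monoid_scheme \<Rightarrow> 'w set \<Rightarrow> (nat \<Rightarrow> 'w) \<Rightarrow> nat \<Rightarrow> ('w \<Rightarrow> rat)" where
  "x_elem W S s j = x_set W S (if j = 1 then {} else s ` {1..j})"

definition E_algebra ::
    "('w, 'm) monoid_scheme \<Rightarrow> 'w set \<Rightarrow> (nat \<Rightarrow> 'w) \<Rightarrow> nat \<Rightarrow> (rat, 'w \<Rightarrow> rat) module" where
  "E_algebra W S s n = generated_subalgebra (group_algebra W) {x_elem W S s (n - 1)}"

definition D_ideal :: "nat \<Rightarrow> rat poly set" where
  "D_ideal n =
     PIdl\<^bsub>poly_algebra\<^esub> (falling_power [:0, 1:] n - falling_power [:0, 1:] (n - 1))"

end

theory Submission
  imports Defs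
begin

text \<open>The presentation makes \<open>W\<close> act on the integers, \<open>s\<^sub>i\<close> exchanging \<open>i - 1\<close> and \<open>i\<close> (and their
  negatives) for \<open>i \<ge> 2\<close>, and \<open>s\<^sub>1\<close> exchanging \<open>- 1\<close> and \<open>2\<close>. The usual argument with dihedral
  subgroups shows that \<open>s\<^sub>i\<close> is an ascent of \<open>w\<close> iff \<open>w\<close> sends the \<open>i\<close>-th simple root to a positive
  root. Hence \<open>w\<close> occurs in \<open>x\<^sub>j\<close> iff \<open>\<bar>w 1\<bar> < w 2 < \<dots> < w j\<close>, and an element of the support of
  \<open>x\<^sub>n\<^sub>-\<^sub>1\<close> is determined by the image of \<open>n\<close>, which can be any of \<open>\<plusminus>1, \<dots>, \<plusminus>n\<close>. Counting
  the factorisations of a given \<open>w\<close> yields \<open>x\<^sub>n\<^sub>-\<^sub>1 x\<^sub>j = 2 (n - j) x\<^sub>j + x\<^sub>j\<^sub>-\<^sub>1\<close> for \<open>j \<ge> 2\<close> and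
  \<open>x\<^sub>n\<^sub>-\<^sub>1 x\<^sub>1 = 2 n x\<^sub>1\<close>. So \<open>x\<^sub>n\<^sub>-\<^sub>k\<close> is \<open>2\<^sup>k\<close> times the \<open>k\<close>-th falling power of \<open>x\<^sub>n\<^sub>-\<^sub>1 / 2\<close> for
  \<open>k < n\<close>, these elements are independent because their supports are strictly nested, and the
  last equation is the relation \<open>x\<^sup>n = x\<^sup>n\<^sup>-\<^sup>1\<close> between falling powers.\<close>

section \<open>Signed permutations\<close>

text \<open>For \<open>i \<ge> 1\<close> this is the reflection in the \<open>i\<close>-th simple
  root, written on the indices of signed coordinate vectors. With all integers as domain, agreement
  of two actions is plain equality of functions.\<close>

definition sgen :: "nat \<Rightarrow> int \<Rightarrow> int" where
  "sgen i x = (let a = (if i = 1 then -1 else int i - 1); b = (if i = 1 then 2 else int i) in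
     if x = a then b else if x = b then a else if x = -a then -b else if x = -b then -a else x)"

lemma sgen_1: "sgen (Suc 0) x = (if x = -1 then 2 else if x = 2 then -1 else if x = 1 then -2
    else if x = -2 then 1 else x)"
  by (simp add: sgen_def)

lemma sgen_ge2: "2 \<le> i \<Longrightarrow> sgen i x = (if x = int i - 1 then int i else if x = int i then int i - 1
    else if x = 1 - int i then - int i else if x = - int i then 1 - int i else x)"
  by (simp add: sgen_def)

lemma sgen_sgen [simp]: "i \<ge> 1 \<Longrightarrow> sgen i (sgen i x) = x"
  by (cases "i = 1") (simp_all add: sgen_1 sgen_ge2)

lemma sgen_minus: "i \<ge> 1 \<Longrightarrow> sgen i (- x) = - sgen i x"
  by (cases "i = 1") (simp_all add: sgen_1 sgen_ge2)

text \<open>Sorts the non-edges of the Dynkin diagram so that in each case the indices moved by the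
  two reflections form either the same set (for \<open>1\<close> and \<open>2\<close>) or disjoint
  sets.\<close>

lemma type_D_commute_cases:
  assumes "1 \<le> i" "i < j" "\<not> type_D_edge n i j" "j \<le> n"
  obtains "i = 1" "j = 2" | "i = 1" "4 \<le> j" | "2 \<le> i" "i + 2 \<le> j"
proof -
  have "(i = 1 \<and> j = 2) \<or> (i = 1 \<and> 4 \<le> j) \<or> (2 \<le> i \<and> i + 2 \<le> j)"
    using assms unfolding type_D_edge_def by presburger
  then show ?thesis using that by blast
qed

lemma type_D_edge_cases:
  assumes "type_D_edge n i j"
  obtains "i = 1" "j = 3" | "2 \<le> i" "j = i + 1"
  using assms by (auto simp: type_D_edge_def)

lemma sgen_commute:
  assumes "1 \<le> i" "i < j" "\<not> type_D_edge n i j" "j \<le> n"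
  shows "sgen i (sgen j x) = sgen j (sgen i x)"
proof (cases rule: type_D_commute_cases[OF assms])
  case 1
  then show ?thesis by (simp add: sgen_1 sgen_ge2)
next
  case 2
  then consider "x \<in> {1, -1, 2, -2}" | "x \<in> {int j - 1, int j, 1 - int j, - int j}"
    | "x \<notin> {1, -1, 2, -2}" "x \<notin> {int j - 1, int j, 1 - int j, - int j}" by blast
  then show ?thesis
    by cases (use 2 in \<open>auto simp: sgen_1 sgen_ge2\<close>)
next
  case 3
  then consider "x \<in> {int i - 1, int i, 1 - int i, - int i}"
    | "x \<in> {int j - 1, int j, 1 - int j, - int j}"
    | "x \<notin> {int i - 1, int i, 1 - int i, - int i}" "x \<notin> {int j - 1, int j, 1 - int j, - int j}"
    by blast
  then show ?thesis
    by cases (use 3 in \<open>auto simp: sgen_ge2\<close>)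
qed

lemma sgen_braid:
  assumes "type_D_edge n i j"
  shows "sgen i (sgen j (sgen i x)) = sgen j (sgen i (sgen j x))"
proof (cases rule: type_D_edge_cases[OF assms])
  case 1
  consider "x \<in> {1, -1, 2, -2, 3, -3}" | "x \<notin> {1, -1, 2, -2, 3, -3}" by blast
  then show ?thesis
    by cases (use 1 in \<open>auto simp: sgen_1 sgen_ge2\<close>)
next
  case 2
  then consider "x \<in> {int i - 1, int i, 1 - int i, - int i, int i + 1, - int i - 1}"
    | "x \<notin> {int i - 1, int i, 1 - int i, - int i, int i + 1, - int i - 1}" by blast
  then show ?thesis
    by cases (use 2 in \<open>auto simp: sgen_ge2\<close>)
qed

text \<open>The value of the linear extension of \<open>e\<^sub>a \<mapsto> f a\<close> at the simple root \<open>\<alpha>\<^sub>1 = e\<^sub>1 + e\<^sub>2\<close> or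
  \<open>\<alpha>\<^sub>i = e\<^sub>i - e\<^sub>i\<^sub>-\<^sub>1\<close>. For a signed permutation \<open>f\<close> it is positive iff \<open>f\<close> sends \<open>\<alpha>\<^sub>i\<close> to a
  positive root.\<close>

definition ht :: "(int \<Rightarrow> int) \<Rightarrow> nat \<Rightarrow> int" where
  "ht f i = (if i = 1 then f 2 + f 1 else f (int i) - f (int i - 1))"

definition odd_map :: "(int \<Rightarrow> int) \<Rightarrow> bool" where
  "odd_map f \<longleftrightarrow> (\<forall>x. f (- x) = - f x)"

lemma odd_mapD: "odd_map f \<Longrightarrow> f (- x) = - f x"
  by (simp add: odd_map_def)

lemma odd_map_1: "odd_map f \<Longrightarrow> f (- 1) = - f 1" "odd_map f \<Longrightarrow> f (- 2) = - f 2"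
  by (simp_all add: odd_map_def)

text \<open>A simple reflection negates its own root, fixes the orthogonal simple roots and adds its
  root to an adjacent one. This lemma and the next two record the effect on \<open>ht\<close>, which
  is linear in the root.\<close>

lemma ht_sgen_same: "odd_map f \<Longrightarrow> 1 \<le> i \<Longrightarrow> ht (f \<circ> sgen i) i = - ht f i"
  by (cases "i = 1") (simp_all add: ht_def odd_map_1 sgen_1 sgen_ge2)

lemma ht_sgen_commute:
  assumes "odd_map f" "1 \<le> i" "i < j" "\<not> type_D_edge n i j" "j \<le> n"
  shows "ht (f \<circ> sgen j) i = ht f i" "ht (f \<circ> sgen i) j = ht f j"
  by (rule type_D_commute_cases[OF assms(2-5)];
      use assms(1) in \<open>simp add: ht_def odd_map_1 sgen_1 sgen_ge2\<close>)+

lemma ht_sgen_edge: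
  assumes "odd_map f" "type_D_edge n i j"
  shows "ht (f \<circ> sgen j) i = ht f i + ht f j" "ht (f \<circ> sgen i) j = ht f i + ht f j"
  by (rule type_D_edge_cases[OF assms(2)];
      use assms(1) in \<open>simp add: ht_def odd_map_1 sgen_1 sgen_ge2\<close>)+

section \<open>The action of a Coxeter group of type D\<close>

locale coxeter_D =
  fixes W :: "('w, 'm) monoid_scheme" (structure)
    and S :: "'w set" and s :: "nat \<Rightarrow> 'w" and n :: nat
  assumes n3: "3 \<le> n" and type_D: "coxeter_system_type_D W S s n"
begin

lemma cox: "coxeter_system W S" and s_bij: "bij_betw s {1..n} S"
  using type_D by (auto simp: coxeter_system_type_D_def)

lemma group_W: "group W"
  using cox by (simp add: coxeter_system_def)

sublocale group W by (rule group_W)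

lemma S_carrier: "S \<subseteq> carrier W"
  using cox by (simp add: coxeter_system_def)

lemma S_carrierD [simp]: "t \<in> S \<Longrightarrow> t \<in> carrier W"
  using S_carrier by blast

lemma gen_in_S: "i \<in> {1..n} \<Longrightarrow> s i \<in> S"
  using s_bij by (auto simp: bij_betw_def)

lemma gen_carrier [simp]: "1 \<le> i \<Longrightarrow> i \<le> n \<Longrightarrow> s i \<in> carrier W"
  using gen_in_S S_carrier by auto

lemma S_square:
  assumes "t \<in> S" shows "t \<otimes> t = \<one>"
proof -
  have "ord t = 2" "t \<in> carrier W" using cox assms by (auto simp: coxeter_system_def)
  then have "t [^] (2::nat) = \<one>" by (metis pow_ord_eq_1)
  then show ?thesis using \<open>t \<in> carrier W\<close> by (simp add: numeral_2_eq_2)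
qed

lemma gen_square [simp]: "1 \<le> i \<Longrightarrow> i \<le> n \<Longrightarrow> s i \<otimes> s i = \<one>"
  using S_square gen_in_S by simp

lemma gen_cancel [simp]:
  "1 \<le> i \<Longrightarrow> i \<le> n \<Longrightarrow> w \<in> carrier W \<Longrightarrow> w \<otimes> s i \<otimes> s i = w"
  by (simp add: m_assoc)

lemma gen_commute:
  assumes "1 \<le> i" "i < j" "j \<le> n" "\<not> type_D_edge n i j"
  shows "s i \<otimes> s j = s j \<otimes> s i"
proof -
  have "i \<in> {1..n}" "j \<in> {1..n}" using assms by auto
  with type_D assms(2,4) show ?thesis unfolding coxeter_system_type_D_def by meson
qed

lemma ord_edge:
  assumes "1 \<le> i" "i < j" "j \<le> n" "type_D_edge n i j"
  shows "ord (s i \<otimes> s j) = 3"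
proof -
  have "i \<in> {1..n}" "j \<in> {1..n}" using assms by auto
  with type_D assms(2,4) show ?thesis unfolding coxeter_system_type_D_def by meson
qed

lemma inv_S: "t \<in> S \<Longrightarrow> inv t = t"
  using S_square S_carrier by (metis inv_equality subsetD)

text \<open>Commuting involutions only give an order dividing 2; injectivity of the labelling
  \<open>s\<close> excludes order 1. The exact order is what the relators in
  \<open>coxeter_step\<close> are built from.\<close>

lemma ord_commute:
  assumes "1 \<le> i" "i < j" "j \<le> n" "\<not> type_D_edge n i j"
  shows "ord (s i \<otimes> s j) = 2"
proof -
  let ?x = "s i \<otimes> s j"
  have c: "s i \<in> carrier W" "s j \<in> carrier W" using assms by auto
  have "?x [^] (2::nat) = s i \<otimes> s j \<otimes> (s j \<otimes> s i)"
    using c gen_commute[OF assms] by (simp add: numeral_2_eq_2)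
  also have "\<dots> = \<one>" using c assms by (simp flip: m_assoc)
  finally have "ord ?x dvd 2" using c pow_eq_id[of ?x 2] by simp
  moreover have "ord ?x \<noteq> 1"
  proof
    assume "ord ?x = 1"
    then have "?x = \<one>" using c ord_eq_1 by blast
    then have "s i = inv (s j)" using c by (metis inv_equality)
    then have "s i = s j" using inv_S gen_in_S assms by simp
    moreover have "inj_on s {1..n}" using s_bij by (simp add: bij_betw_def)
    ultimately have "i = j" using assms by (auto dest: inj_onD)
    then show False using assms by simp
  qed
  ultimately show ?thesis using prime_nat_iff two_is_prime_nat by blast
qed

lemma ord_swap:
  assumes "1 \<le> i" "i \<le> n" "1 \<le> j" "j \<le> n"
  shows "ord (s j \<otimes> s i) = ord (s i \<otimes> s j)"
proof -
  have "s j \<otimes> s i = inv (s i \<otimes> s j)"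
    using assms by (simp add: inv_mult_group inv_S gen_in_S)
  then show ?thesis using assms by simp
qed

lemma gen_braid:
  assumes "1 \<le> i" "i < j" "j \<le> n" "type_D_edge n i j"
  shows "s i \<otimes> s j \<otimes> s i = s j \<otimes> s i \<otimes> s j"
proof -
  let ?a = "s i" and ?b = "s j"
  have c: "?a \<in> carrier W" "?b \<in> carrier W" using assms by auto
  have "(?a \<otimes> ?b) [^] (3::nat) = \<one>"
    using ord_edge[OF assms] c pow_ord_eq_1[of "?a \<otimes> ?b"] by simp
  then have "?a \<otimes> ?b \<otimes> ?a \<otimes> (?b \<otimes> ?a \<otimes> ?b) = \<one>"
    using c by (simp add: numeral_3_eq_3 m_assoc)
  then have "?a \<otimes> ?b \<otimes> ?a = inv (?b \<otimes> ?a \<otimes> ?b)"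
    using c by (metis inv_equality m_closed)
  also have "\<dots> = ?b \<otimes> ?a \<otimes> ?b"
    using c assms by (simp add: inv_mult_group inv_S gen_in_S m_assoc)
  finally show ?thesis .
qed

section \<open>Words in the generators and the length function\<close>

lemma word_prod_simps [simp]:
  "word_prod W [] = \<one>" "word_prod W (t # us) = t \<otimes> word_prod W us"
  by (simp_all add: word_prod_def)

lemma word_prod_closed [simp]: "\<forall>t\<in>set us. t \<in> S \<Longrightarrow> word_prod W us \<in> carrier W"
  by (induct us) auto

lemma word_prod_append:
  "us \<in> lists S \<Longrightarrow> vs \<in> lists S \<Longrightarrow> word_prod W (us @ vs) = word_prod W us \<otimes> word_prod W vs"
  by (induct us) (auto simp: m_assoc)

lemma word_prod_rev:
  "us \<in> lists S \<Longrightarrow> word_prod W (rev us) = inv (word_prod W us)"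
proof (induct us)
  case (Cons t us)
  then have "rev us \<in> lists S" by auto
  with Cons show ?case
    by (auto simp: word_prod_append inv_mult_group inv_S)
qed auto

lemma word_exists:
  assumes "w \<in> carrier W" obtains us where "us \<in> lists S" "word_prod W us = w"
proof -
  have "w \<in> generate W S" using assms cox by (simp add: coxeter_system_def)
  then have "\<exists>us\<in>lists S. word_prod W us = w"
  proof induct
    case one
    then show ?case by (intro bexI[of _ "[]"]) auto
  next
    case (incl h)
    then show ?case using S_carrier by (intro bexI[of _ "[h]"]) auto
  next
    case (inv h)
    then show ?case using S_carrier inv_S by (intro bexI[of _ "[h]"]) auto
  next
    case (eng h1 h2)
    then obtain us vs where "us \<in> lists S" "vs \<in> lists S" "word_prod W us = h1" "word_prod W vs = h2"
      by blast
    then show ?case by (intro bexI[of _ "us @ vs"]) (auto simp: word_prod_append)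
  qed
  then show ?thesis using that by blast
qed

abbreviation len :: "'w \<Rightarrow> nat" where "len \<equiv> coxeter_length W S"

lemma len_le: "us \<in> lists S \<Longrightarrow> len (word_prod W us) \<le> length us"
  unfolding coxeter_length_def by (rule Least_le) auto

lemma reduced_word:
  assumes "w \<in> carrier W"
  obtains us where "us \<in> lists S" "word_prod W us = w" "length us = len w"
proof -
  obtain us where "us \<in> lists S" "word_prod W us = w" using word_exists[OF assms] .
  then have "\<exists>k. \<exists>us\<in>lists S. length us = k \<and> word_prod W us = w" by blast
  from LeastI_ex[OF this] show ?thesis using that unfolding coxeter_length_def by blast
qed

lemma len_mult_gen_le:
  assumes "w \<in> carrier W" "1 \<le> i" "i \<le> n"
  shows "len (w \<otimes> s i) \<le> len w + 1"
proof -
  obtain us where us: "us \<in> lists S" "word_prod W us = w" "length us = len w"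
    using reduced_word[OF assms(1)] .
  have "us @ [s i] \<in> lists S" using us assms gen_in_S by auto
  from len_le[OF this] show ?thesis
    using us assms gen_in_S by (simp add: word_prod_append)
qed

text \<open>The last letter of a reduced word is a descent.\<close>

lemma descent_exists:
  assumes "w \<in> carrier W" "w \<noteq> \<one>"
  obtains i where "1 \<le> i" "i \<le> n" "len (w \<otimes> s i) < len w"
proof -
  obtain us where us: "us \<in> lists S" "word_prod W us = w" "length us = len w"
    using reduced_word[OF assms(1)] .
  then have "us \<noteq> []" using assms by auto
  then obtain vs t where vs: "us = vs @ [t]" by (metis rev_exhaust)
  with us have "t \<in> S" "vs \<in> lists S" by auto
  then obtain i where i: "1 \<le> i" "i \<le> n" "t = s i" using s_bij by (auto simp: bij_betw_def)
  have "w \<otimes> s i = word_prod W vs"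
    using us(2) vs word_prod_append[of vs "[t]"] \<open>vs \<in> lists S\<close> \<open>t \<in> S\<close> i by auto
  then have "len (w \<otimes> s i) < len w" using len_le[OF \<open>vs \<in> lists S\<close>] us(3) vs by simp
  with i that show ?thesis by blast
qed

section \<open>The action of words, and then of group elements, on the integers\<close>

definition idx :: "'w \<Rightarrow> nat" where "idx = inv_into {1..n} s"

lemma idx_gen [simp]: "1 \<le> i \<Longrightarrow> i \<le> n \<Longrightarrow> idx (s i) = i"
  using s_bij by (auto simp: idx_def bij_betw_def)

lemma S_cases:
  assumes "t \<in> S" obtains i where "1 \<le> i" "i \<le> n" "t = s i"
  using assms s_bij by (auto simp: bij_betw_def)

definition act :: "'w list \<Rightarrow> int \<Rightarrow> int" where
  "act us = foldr (\<lambda>t f. sgen (idx t) \<circ> f) us id"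

lemma act_simps [simp]: "act [] = id" "act (t # us) = sgen (idx t) \<circ> act us"
  by (simp_all add: act_def)

lemma act_append: "act (us @ vs) = act us \<circ> act vs"
  by (induct us) auto

lemma act_rev: "us \<in> lists S \<Longrightarrow> act us \<circ> act (rev us) = id"
proof (induct us)
  case (Cons t us)
  then obtain i where "1 \<le> i" "i \<le> n" "t = s i" by (auto elim: S_cases)
  then show ?case using Cons by (auto simp: act_append fun_eq_iff)
qed simp

text \<open>The order is 1, 3 or 2, and the relator becomes the involution, braid or commutation law
  for \<open>sgen\<close>. For pairs with \<open>j < i\<close>, \<open>ord_swap\<close> supplies the
  order.\<close>

lemma act_relator:
  assumes "t \<in> S" "u \<in> S"
  shows "act (concat (replicate (ord (t \<otimes> u)) [t, u])) = id"
proof -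
  obtain i j where i: "1 \<le> i" "i \<le> n" "t = s i" and j: "1 \<le> j" "j \<le> n" "u = s j"
    using assms by (auto elim!: S_cases)
  consider "i = j" | "i < j" "type_D_edge n i j" | "i < j" "\<not> type_D_edge n i j"
    | "j < i" "type_D_edge n j i" | "j < i" "\<not> type_D_edge n j i" by linarith
  then show ?thesis
  proof cases
    case 1
    then have "ord (t \<otimes> u) = 1" using i j by (simp add: ord_eq_1)
    then show ?thesis using i j 1 by (simp add: fun_eq_iff)
  next
    case 2
    then have "ord (t \<otimes> u) = 3" using i j by (simp add: ord_edge)
    then show ?thesis using i j sgen_braid[OF 2(2)]
      by (simp add: fun_eq_iff numeral_3_eq_3)
  next
    case 3
    then have "ord (t \<otimes> u) = 2" using i j by (simp add: ord_commute)
    then show ?thesis using i j sgen_commute[OF i(1) 3 j(2)]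
      by (simp add: fun_eq_iff numeral_2_eq_2)
  next
    case 4
    then have "ord (t \<otimes> u) = 3" using i j by (simp add: ord_edge ord_swap[of j i])
    then show ?thesis using i j sgen_braid[OF 4(2)]
      by (simp add: fun_eq_iff numeral_3_eq_3)
  next
    case 5
    then have "ord (t \<otimes> u) = 2" using i j by (simp add: ord_commute ord_swap[of j i])
    then show ?thesis using i j sgen_commute[OF j(1) 5 i(2)]
      by (simp add: fun_eq_iff numeral_2_eq_2)
  qed
qed

lemma act_step:
  assumes "coxeter_step W S us vs" shows "act us = act vs"
  using assms act_relator unfolding coxeter_step_def by (auto simp: act_append)

text \<open>Here the presentation of \<open>W\<close> enters: a word for \<open>\<one>\<close> is
  linked to the empty word by steps that all preserve \<open>act\<close>. Two words with the same
  product are compared through \<open>us @ rev vs\<close>.\<close>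

lemma act_cong:
  assumes "us \<in> lists S" "vs \<in> lists S" "word_prod W us = word_prod W vs"
  shows "act us = act vs"
proof -
  have triv: "act ws = id" if "ws \<in> lists S" "word_prod W ws = \<one>" for ws
  proof -
    have "equivclp (coxeter_step W S) ws []" using cox that by (simp add: coxeter_system_def)
    then have "act ws = act []"
      by (induct rule: equivclp_induct) (auto dest: act_step)
    then show ?thesis by simp
  qed
  have "rev vs \<in> lists S" using assms(2) by auto
  then have "act (us @ rev vs) = id" "act vs \<circ> act (rev vs) = id" "act (rev vs) \<circ> act vs = id"
    using assms triv[of "us @ rev vs"] act_rev[of vs] act_rev[of "rev vs"]
    by (auto simp: word_prod_append word_prod_rev)
  then show ?thesis by (metis act_append comp_assoc comp_id id_comp)
qed

definition rho :: "'w \<Rightarrow> int \<Rightarrow> int" where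
  "rho w = act (SOME us. us \<in> lists S \<and> word_prod W us = w)"

lemma rho_word_prod: "us \<in> lists S \<Longrightarrow> rho (word_prod W us) = act us"
  unfolding rho_def by (rule act_cong; use someI[of "\<lambda>vs. vs \<in> lists S \<and> word_prod W vs = word_prod W us" us] in simp)

lemma rho_one [simp]: "rho \<one> = id"
  using rho_word_prod[of "[]"] by simp

lemma rho_gen [simp]: "1 \<le> i \<Longrightarrow> i \<le> n \<Longrightarrow> rho (s i) = sgen i"
  using rho_word_prod[of "[s i]"] gen_in_S[of i] by simp

lemma rho_mult [simp]:
  assumes "v \<in> carrier W" "w \<in> carrier W" shows "rho (v \<otimes> w) = rho v \<circ> rho w"
proof -
  obtain us where us: "us \<in> lists S" "word_prod W us = v" using word_exists assms by blast
  obtain vs where vs: "vs \<in> lists S" "word_prod W vs = w" using word_exists assms by blast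
  have "rho (v \<otimes> w) = act (us @ vs)"
    using us vs by (subst rho_word_prod[symmetric]) (auto simp: word_prod_append)
  then show ?thesis using us vs rho_word_prod[OF us(1)] rho_word_prod[OF vs(1)]
    by (simp add: act_append)
qed

lemma rho_inv [simp]: "w \<in> carrier W \<Longrightarrow> rho w (rho (inv w) x) = x"
  "w \<in> carrier W \<Longrightarrow> rho (inv w) (rho w x) = x"
  using rho_mult[of w "inv w"] rho_mult[of "inv w" w] by (simp_all add: fun_eq_iff)

text \<open>The new letter stands on the left, so that in an induction step only the outermost
  \<open>sgen i\<close> of \<open>rho\<close> has to be examined.\<close>

lemma W_induct [consumes 1, case_names one mult]:
  assumes "w \<in> carrier W" "P \<one>"
    and "\<And>w i. w \<in> carrier W \<Longrightarrow> P w \<Longrightarrow> 1 \<le> i \<Longrightarrow> i \<le> n \<Longrightarrow> P (s i \<otimes> w)"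
  shows "P w"
proof -
  obtain us where "us \<in> lists S" "word_prod W us = w" using word_exists[OF assms(1)] .
  moreover have "us \<in> lists S \<Longrightarrow> P (word_prod W us)" for us
    by (induct us) (auto intro: assms elim!: S_cases)
  ultimately show ?thesis by fastforce
qed

lemma rho_minus: "w \<in> carrier W \<Longrightarrow> rho w (- x) = - rho w x"
  by (induct w rule: W_induct) (auto simp: sgen_minus)

lemma odd_rho: "w \<in> carrier W \<Longrightarrow> odd_map (rho w)"
  by (simp add: odd_map_def rho_minus)

definition signed :: "int set" where "signed = {- int n..int n} - {0}"

lemma rho_signed: "w \<in> carrier W \<Longrightarrow> rho w x \<in> signed \<longleftrightarrow> x \<in> signed"
proof (induct w rule: W_induct)
  case (mult w i)
  have "sgen i y \<in> signed \<longleftrightarrow> y \<in> signed" for y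
    using mult n3 by (auto simp: sgen_def signed_def Let_def)
  then show ?case using mult by simp
qed simp

lemma rho_outside: "w \<in> carrier W \<Longrightarrow> x \<notin> signed \<Longrightarrow> rho w x = x"
proof (induct w rule: W_induct)
  case (mult w i)
  have "y \<notin> signed \<Longrightarrow> sgen i y = y" for y
    using mult(3,4) n3 by (auto simp: sgen_def signed_def Let_def)
  then show ?case using mult by simp
qed simp

lemma rho_eq_iff [simp]: "w \<in> carrier W \<Longrightarrow> rho w x = rho w y \<longleftrightarrow> x = y"
  by (metis rho_inv(2))

section \<open>Ascents and positive roots\<close>

lemma ht_rho_gen:
  assumes "w \<in> carrier W" "1 \<le> i" "i \<le> n"
  shows "ht (rho (w \<otimes> s i)) i = - ht (rho w) i"
  using assms by (simp add: ht_sgen_same odd_rho)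

text \<open>The induction peels off a last letter \<open>s\<^sub>j\<close> of a reduced word of \<open>w\<close>. In the braid case
  \<open>ht\<close> of \<open>w\<close> at \<open>i\<close> is the sum of its values at \<open>i\<close> and \<open>j\<close> for \<open>v = w s\<^sub>j\<close>; if \<open>i\<close> is a
  descent of \<open>v = u s\<^sub>i\<close>, this sum is the value at \<open>j\<close> for \<open>u\<close>.\<close>

lemma ht_pos:
  assumes "w \<in> carrier W" "1 \<le> i" "i \<le> n" "len w \<le> len (w \<otimes> s i)"
  shows "0 < ht (rho w) i"
  using assms
proof (induct "len w" arbitrary: w i rule: less_induct)
  case less
  note w = less.prems(1) and i = less.prems(2,3) and le = less.prems(4)
  show ?case
  proof (cases "w = \<one>")
    case True
    then show ?thesis by (simp add: ht_def)
  next
    case False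
    then obtain j where j: "1 \<le> j" "j \<le> n" "len (w \<otimes> s j) < len w"
      using descent_exists w by blast
    define v where "v = w \<otimes> s j"
    have v: "v \<in> carrier W" "w = v \<otimes> s j" "len v < len w"
      using w j by (auto simp: v_def)
    have ij: "i \<noteq> j" using le j by auto
    show ?thesis
    proof (cases "type_D_edge n i j \<or> type_D_edge n j i")
      case False
      have comm: "s i \<otimes> s j = s j \<otimes> s i"
        using gen_commute[of i j] gen_commute[of j i] i j ij False by (metis linorder_neqE_nat)
      have ht: "ht (rho w) i = ht (rho v) i"
        using v i j ij False ht_sgen_commute[OF odd_rho, of v i j n]
          ht_sgen_commute[OF odd_rho, of v j i n] by (cases "i < j") auto
      \<comment> \<open>Thus \<open>len w \<le> len (w \<otimes> s i) \<le> len (v \<otimes> s i) +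
        1\<close>, while \<open>len v < len w\<close>; so \<open>i\<close> satisfies the hypothesis
        for the shorter \<open>v\<close>.\<close>
      have "w \<otimes> s i = v \<otimes> s i \<otimes> s j" using v i j comm by (simp add: m_assoc)
      then have "len v \<le> len (v \<otimes> s i)"
        using len_mult_gen_le[of "v \<otimes> s i" j] v i j le by simp
      then show ?thesis using less.hyps[OF v(3,1) i] ht by simp
    next
      case True
      have braid: "s i \<otimes> s j \<otimes> s i = s j \<otimes> s i \<otimes> s j"
        using gen_braid[of i j] gen_braid[of j i] i j True by (auto simp: type_D_edge_def)
      have sum: "ht (rho x \<circ> sgen j) i = ht (rho x) i + ht (rho x) j"
        "ht (rho x \<circ> sgen i) j = ht (rho x) i + ht (rho x) j" if "x \<in> carrier W" for x
        using True ht_sgen_edge[OF odd_rho[OF that], of n i j]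
          ht_sgen_edge[OF odd_rho[OF that], of n j i] by auto
      have ht: "ht (rho w) i = ht (rho v) i + ht (rho v) j" using v j sum by simp
      show ?thesis
      proof (cases "len v \<le> len (v \<otimes> s i)")
        case True
        have "len v \<le> len (v \<otimes> s j)" using v(2,3) by simp
        then have "0 < ht (rho v) j" using less.hyps[OF v(3,1) j(1,2)] by blast
        moreover have "0 < ht (rho v) i" using less.hyps[OF v(3,1) i] True by blast
        ultimately show ?thesis using ht by simp
      next
        case False
        define u where "u = v \<otimes> s i"
        have u: "u \<in> carrier W" "v = u \<otimes> s i" "len u < len v"
          using v i False by (auto simp: u_def)
        have "ht (rho v) i = - ht (rho u) i" using ht_rho_gen u i by simp
        moreover have "ht (rho v) j = ht (rho u) i + ht (rho u) j" using sum u i by simp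
        ultimately have "ht (rho w) i = ht (rho u) j" using ht by simp
        \<comment> \<open>If \<open>s j\<close> were a descent of \<open>u\<close>, then writing
          \<open>w \<otimes> s i\<close> as
          \<open>u \<otimes> s j \<otimes> s i \<otimes> s j\<close> would bound its length by
          \<open>len u + 1 \<le> len v < len w\<close>.\<close>
        moreover have "len u \<le> len (u \<otimes> s j)"
        proof (rule ccontr)
          assume "\<not> len u \<le> len (u \<otimes> s j)"
          moreover have "w \<otimes> s i = u \<otimes> s j \<otimes> s i \<otimes> s j"
            using u v i j braid by (simp add: m_assoc)
          then have "len (w \<otimes> s i) \<le> len (u \<otimes> s j) + 2"
            using len_mult_gen_le[of "u \<otimes> s j" i] len_mult_gen_le[of "u \<otimes> s j \<otimes> s i" j] u i j by simp
          ultimately show False using u v le by linarith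
        qed
        then have "0 < ht (rho u) j" using less.hyps[OF _ u(1) j(1,2)] u v by simp
        ultimately show ?thesis by simp
      qed
    qed
  qed
qed

text \<open>For the converse, if \<open>i\<close> is not an ascent of \<open>w\<close>, then the
  length does not drop on passing from \<open>w \<otimes> s i\<close> back to \<open>w\<close>. So
  \<open>ht_pos\<close> applies to \<open>w \<otimes> s i\<close>, whose \<open>ht\<close> at
  \<open>i\<close> is the negative of that of \<open>w\<close>.\<close>

lemma ascent_iff_ht:
  assumes "w \<in> carrier W" "1 \<le> i" "i \<le> n"
  shows "len w < len (w \<otimes> s i) \<longleftrightarrow> 0 < ht (rho w) i"
proof
  assume "len w < len (w \<otimes> s i)"
  then show "0 < ht (rho w) i" using ht_pos assms by simp
next
  assume pos: "0 < ht (rho w) i"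
  show "len w < len (w \<otimes> s i)"
  proof (rule ccontr)
    assume "\<not> ?thesis"
    then have "0 < ht (rho (w \<otimes> s i)) i" using assms by (intro ht_pos) auto
    then show False using pos ht_rho_gen assms by simp
  qed
qed

end

section \<open>Coset representatives\<close>

text \<open>For \<open>j \<ge> 2\<close> this says \<open>\<bar>f 1\<bar> < f 2 < \<dots> < f j\<close>; for \<open>j = 1\<close> it is void, in accordance
  with \<open>x\<^sub>1 = x\<^sub>\<emptyset>\<close>.\<close>

definition chain :: "(int \<Rightarrow> int) \<Rightarrow> nat \<Rightarrow> bool" where
  "chain f j \<longleftrightarrow> (\<forall>i\<in>{1..<j}. \<bar>f (int i)\<bar> < f (int i + 1))"

text \<open>The conditions at 1 and 2 are \<open>0 < f 2 + f 1\<close> and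
  \<open>0 < f 2 - f 1\<close>, that is \<open>\<bar>f 1\<bar> < f 2\<close>. From there on the
  values are positive, so plain increase implies the inequality with absolute values. At
  \<open>j = 1\<close> the right side would still constrain \<open>f 2\<close>, hence the bound on
  \<open>j\<close>.\<close>

lemma chain_iff_ht:
  assumes "2 \<le> j"
  shows "chain f j \<longleftrightarrow> (\<forall>i\<in>{1..j}. 0 < ht f i)"
proof
  assume c: "chain f j"
  show "\<forall>i\<in>{1..j}. 0 < ht f i"
  proof
    fix i assume i: "i \<in> {1..j}"
    show "0 < ht f i"
    proof (cases "i = 1")
      case True
      have "\<bar>f 1\<bar> < f 2" using c assms unfolding chain_def by force
      then show ?thesis using True by (simp add: ht_def)
    next
      case False
      then have "i - 1 \<in> {1..<j}" "int (i - 1) = int i - 1" using i by auto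
      then have "\<bar>f (int i - 1)\<bar> < f (int i)" using c unfolding chain_def by force
      then show ?thesis using False by (simp add: ht_def)
    qed
  qed
next
  assume p: "\<forall>i\<in>{1..j}. 0 < ht f i"
  have "1 \<le> i \<Longrightarrow> i < j \<Longrightarrow> \<bar>f (int i)\<bar> < f (int i + 1)" for i
  proof (induct i rule: nat_induct_at_least)
    case base
    have "0 < ht f 1" "0 < ht f 2" using p assms by auto
    then show ?case by (simp add: ht_def)
  next
    case (Suc i)
    have "i + 2 \<in> {1..j}" using Suc by auto
    then have "0 < ht f (i + 2)" using p by blast
    then have "f (int i + 1) < f (int i + 2)" using Suc by (simp add: ht_def algebra_simps)
    then show ?case using Suc by (simp add: algebra_simps)
  qed
  then show "chain f j" by (simp add: chain_def)
qed

lemma chain_less: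
  assumes "chain f m" "1 \<le> p" "p < q" "q \<le> m"
  shows "\<bar>f (int p)\<bar> < f (int q)"
  using assms(3,4)
proof (induct q rule: less_induct)
  case (less q)
  define r where "r = q - 1"
  have r: "q = Suc r" "r < m" "p \<le> r" "1 \<le> r" using less assms(2) by (auto simp: r_def)
  then have step: "\<bar>f (int r)\<bar> < f (int q)"
    using assms(1) by (auto simp: chain_def add.commute)
  show ?case
  proof (cases "p = r")
    case False
    then have "\<bar>f (int p)\<bar> < f (int r)" using less.hyps[of r] r by simp
    then show ?thesis using step by linarith
  qed (use step in simp)
qed

text \<open>Along a chain the absolute values increase and only \<open>f 1\<close>, the smallest of
  them in absolute value, may be negative. So an odd \<open>f\<close> preserves and reflects the
  very comparison from which \<open>chain\<close> is built; this carries chains through left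
  multiplication.\<close>

lemma chain_abs_less_iff:
  assumes "odd_map f" "chain f m" "1 \<le> \<bar>a\<bar>" "\<bar>a\<bar> \<le> int m" "1 \<le> \<bar>b\<bar>" "\<bar>b\<bar> \<le> int m"
  shows "\<bar>f a\<bar> < f b \<longleftrightarrow> \<bar>a\<bar> < b"
proof -
  have absf: "\<bar>f x\<bar> = \<bar>f \<bar>x\<bar>\<bar>" for x
    using odd_mapD[OF assms(1), of x] by (cases "0 \<le> x") auto
  have mono: "\<bar>f x\<bar> < f \<bar>y\<bar>" if "1 \<le> \<bar>x\<bar>" "\<bar>x\<bar> < \<bar>y\<bar>" "\<bar>y\<bar> \<le> int m" for x y
    using chain_less[OF assms(2), of "nat \<bar>x\<bar>" "nat \<bar>y\<bar>"] that absf[of x] by auto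
  show ?thesis
  proof
    assume "\<bar>a\<bar> < b" then show "\<bar>f a\<bar> < f b" using mono[of a b] assms by auto
  next
    assume less: "\<bar>f a\<bar> < f b"
    have "\<bar>f a\<bar> = \<bar>f b\<bar>" if "\<bar>a\<bar> = \<bar>b\<bar>" using absf that by metis
    then have "\<bar>a\<bar> \<noteq> \<bar>b\<bar>" using less by linarith
    moreover have "\<bar>f b\<bar> < f \<bar>a\<bar>" if "\<bar>b\<bar> < \<bar>a\<bar>" using mono[of b a] that assms by blast
    then have "\<not> \<bar>b\<bar> < \<bar>a\<bar>" using less absf[of a] by linarith
    ultimately have ab: "\<bar>a\<bar> < \<bar>b\<bar>" by linarith
    moreover have "0 < b"
    proof (rule ccontr)
      assume "\<not> 0 < b"
      then have "f \<bar>b\<bar> = - f b" using odd_mapD[OF assms(1), of b] by simp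
      moreover have "\<bar>f a\<bar> < f \<bar>b\<bar>" using mono[of a b] ab assms by blast
      ultimately show False using less by linarith
    qed
    ultimately show "\<bar>a\<bar> < b" by simp
  qed
qed

context coxeter_D
begin

definition reps :: "nat \<Rightarrow> 'w set" where
  "reps j = coset_reps W S (if j = 1 then {} else s ` {1..j})"

lemma reps_iff:
  assumes "1 \<le> j" "j \<le> n"
  shows "w \<in> reps j \<longleftrightarrow> w \<in> carrier W \<and> chain (rho w) j"
proof (cases "j = 1")
  case True
  then show ?thesis by (simp add: reps_def coset_reps_def chain_def)
next
  case False
  have "w \<in> reps j \<longleftrightarrow> w \<in> carrier W \<and> (\<forall>i\<in>{1..j}. 0 < ht (rho w) i)"
    using False assms ascent_iff_ht[of w] by (auto simp: reps_def coset_reps_def)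
  then show ?thesis using chain_iff_ht[of j "rho w"] False assms by simp
qed

lemma reps_carrier: "reps j \<subseteq> carrier W"
  by (auto simp: reps_def coset_reps_def)

lemma reps_1: "reps 1 = carrier W"
  by (simp add: reps_def coset_reps_def)

lemma reps_antimono: "1 \<le> j \<Longrightarrow> j \<le> k \<Longrightarrow> k \<le> n \<Longrightarrow> reps k \<subseteq> reps j"
  by (auto simp: reps_iff chain_def)

lemma one_in_reps: "1 \<le> j \<Longrightarrow> j \<le> n \<Longrightarrow> \<one> \<in> reps j"
  by (simp add: reps_iff chain_def)

lemma reps_n: "reps n = {\<one>}"
proof -
  have "w = \<one>" if "w \<in> reps n" for w
  proof (rule ccontr)
    assume "w \<noteq> \<one>"
    moreover have "w \<in> carrier W" using reps_carrier that by blast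
    ultimately obtain i where "1 \<le> i" "i \<le> n" "len (w \<otimes> s i) < len w"
      using descent_exists[of w] by metis
    moreover have "\<forall>i\<in>{1..n}. len w < len (w \<otimes> s i)"
      using that n3 by (simp add: reps_def coset_reps_def)
    ultimately show False by (meson atLeastAtMost_iff less_asym)
  qed
  then have "reps n \<subseteq> {\<one>}" by blast
  moreover have "\<one> \<in> reps n" using one_in_reps n3 by simp
  ultimately show ?thesis by blast
qed

text \<open>The witness that the inclusion of \<open>reps j\<close> in \<open>reps (j - 1)\<close>
  is strict, on which linear independence will rest.\<close>

lemma gen_in_reps:
  assumes "2 \<le> j" "j \<le> n"
  shows "s j \<in> reps (j - 1)" "s j \<notin> reps j"
proof -
  have "chain (sgen j) (j - 1)"
    using assms by (auto simp: chain_def sgen_ge2)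
  then show "s j \<in> reps (j - 1)" using assms by (simp add: reps_iff)
  have "len (s j) > len \<one>"
    using ascent_iff_ht[of \<one> j] assms by (simp add: ht_def)
  then have "\<not> len (s j) < len (s j \<otimes> s j)" using assms by simp
  moreover have "j \<in> {1..j}" using assms by simp
  ultimately show "s j \<notin> reps j" using assms unfolding reps_def coset_reps_def by fastforce
qed

text \<open>The action is faithful: an element acting as the identity satisfies the chain condition
  up to \<open>n\<close>, so it has no descent and equals \<open>\<one>\<close>.\<close>

lemma rho_inj:
  assumes "v \<in> carrier W" "w \<in> carrier W" "rho v = rho w"
  shows "v = w"
proof -
  have "rho (inv v \<otimes> w) = id" using assms by (metis rho_mult rho_one inv_closed l_inv)
  then have "inv v \<otimes> w \<in> reps n" using assms n3 by (simp add: reps_iff chain_def)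
  then show ?thesis using reps_n assms
    by (metis inv_equality inv_inv inv_closed singletonD)
qed

section \<open>Finiteness of the group and transitivity of the action\<close>

lemma rho_permutes: "w \<in> carrier W \<Longrightarrow> rho w permutes signed"
  unfolding permutes_def by (metis rho_inv rho_outside)

lemma finite_signed: "finite signed"
  by (simp add: signed_def)

text \<open>Finiteness is derived: the faithful action embeds \<open>W\<close> into the permutations
  of the finite set \<open>signed\<close>.\<close>

lemma finite_W: "finite (carrier W)"
proof -
  have "rho ` carrier W \<subseteq> {p. p permutes signed}" by (auto simp: rho_permutes)
  then have "finite (rho ` carrier W)"
    using finite_permutations[OF finite_signed] finite_subset by blast
  then show ?thesis by (rule finite_imageD) (auto intro: inj_onI rho_inj)
qed

text \<open>The generators lead from \<open>n\<close> down to 1 one step at a time,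
  \<open>s 1\<close> takes 2 to -1, and the remaining generators lead from -1 down to
  \<open>- n\<close>.\<close>

lemma rho_transitive:
  assumes "c \<in> signed" obtains w where "w \<in> carrier W" "rho w (int n) = c"
proof -
  let ?P = "\<lambda>c. \<exists>w\<in>carrier W. rho w (int n) = c"
  have "?P (sgen i c)" if c: "?P c" and i: "1 \<le> i" "i \<le> n" for i c
  proof -
    obtain w where "w \<in> carrier W" "rho w (int n) = c" using c by blast
    then show ?thesis using i by (intro bexI[of _ "s i \<otimes> w"]) auto
  qed
  note gen_step = this
  have pos: "?P (int a)" if "1 \<le> a" "a \<le> n" for a
    using that(2,1)
  proof (induct rule: inc_induct)
    case base
    then show ?case by (intro bexI[of _ \<one>]) auto
  next
    case (step a)
    then have "?P (sgen (Suc a) (int (Suc a)))" by (intro gen_step) auto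
    then show ?case using step by (simp add: sgen_ge2)
  qed
  have neg: "?P (- int a)" if "1 \<le> a" "a \<le> n" for a
    using that
  proof (induct rule: nat_induct_at_least)
    case base
    have "?P (sgen 1 (int 2))" using n3 by (intro gen_step pos) auto
    then show ?case by (simp add: sgen_1)
  next
    case (Suc a)
    then have "?P (sgen (Suc a) (- int a))" by (intro gen_step) auto
    then show ?case using Suc by (simp add: sgen_ge2)
  qed
  have "?P c" using pos[of "nat c"] neg[of "nat (- c)"] assms
    by (cases "0 < c") (auto simp: signed_def)
  then show ?thesis using that by blast
qed

text \<open>An element of minimal length among those sending \<open>n\<close> to \<open>c\<close> lies in \<open>reps (n - 1)\<close>,
  because \<open>s\<^sub>1, \<dots>, s\<^sub>n\<^sub>-\<^sub>1\<close> fix \<open>n\<close>.\<close>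

lemma reps_pred_exists:
  assumes "c \<in> signed" obtains u where "u \<in> reps (n - 1)" "rho u (int n) = c"
proof -
  let ?P = "\<lambda>w. w \<in> carrier W \<and> rho w (int n) = c"
  have "\<exists>w. ?P w" using rho_transitive[OF assms] by metis
  then obtain u where u: "?P u" and least: "\<And>w. ?P w \<Longrightarrow> len u \<le> len w"
    using ex_has_least_nat[of ?P _ len] by blast
  have "0 < ht (rho u) i" if "i \<in> {1..n - 1}" for i
  proof (rule ht_pos)
    have "sgen i (int n) = int n" using that n3 by (auto simp: sgen_def Let_def)
    then show "len u \<le> len (u \<otimes> s i)" using u that by (intro least) auto
  qed (use u that in auto)
  then have "u \<in> reps (n - 1)" using u n3 chain_iff_ht[of "n - 1" "rho u"] by (simp add: reps_iff)
  with u that show ?thesis by blast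
qed

text \<open>Let \<open>v = inv u \<otimes> w\<close> take a value \<open>\<plusminus>n\<close> at
  position \<open>l\<close>. Away from \<open>l\<close>, \<open>u\<close> preserves the comparisons,
  so \<open>v\<close> and \<open>w\<close> form chains together. If \<open>l > j\<close>, the
  condition is that \<open>w\<close> lies in \<open>reps j\<close>. If \<open>l = j\<close>, the
  last comparison for \<open>v\<close> holds iff the value is \<open>+n\<close>, and
  \<open>w\<close> is constrained only up to \<open>j - 1\<close>. If \<open>l < j\<close>, no value
  can follow \<open>\<plusminus>n\<close> in a chain.\<close>

lemma quotient_in_reps_iff:
  assumes u: "u \<in> reps (n - 1)" and w: "w \<in> carrier W" and j: "2 \<le> j" "j \<le> n"
  shows "inv u \<otimes> w \<in> reps j \<longleftrightarrow>
    (w \<in> reps j \<and> (\<exists>l\<in>{j<..n}. \<bar>rho u (int n)\<bar> = \<bar>rho w (int l)\<bar>)) \<or>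
    (rho u (int n) = rho w (int j) \<and> w \<in> reps (j - 1))"
proof -
  define v where "v = inv u \<otimes> w"
  have uc: "u \<in> carrier W" and chu: "chain (rho u) (n - 1)" using u n3 reps_iff[of "n - 1"] by auto
  have vc: "v \<in> carrier W" using uc w by (simp add: v_def)
  have h: "rho w x = rho u (rho v x)" for x
    using uc w by (simp add: v_def)
  have abs_rho: "\<bar>rho x y\<bar> = \<bar>rho x z\<bar> \<longleftrightarrow> \<bar>y\<bar> = \<bar>z\<bar>" if "x \<in> carrier W" for x y z
    by (simp only: abs_eq_iff rho_minus[OF that, symmetric] rho_eq_iff[OF that])
  have range: "1 \<le> \<bar>rho v (int i)\<bar> \<and> \<bar>rho v (int i)\<bar> \<le> int n" if "1 \<le> i" "i \<le> n" for i
    using rho_signed[OF vc, of "int i"] that by (auto simp: signed_def)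
  \<comment> \<open>The position, up to sign, that \<open>v\<close> sends to
    \<open>\<plusminus>n\<close>.\<close>
  define l where "l = nat \<bar>rho (inv v) (int n)\<bar>"
  have l: "1 \<le> l" "l \<le> n" using rho_signed[of "inv v" "int n"] vc n3 by (auto simp: l_def signed_def)
  have vl: "\<bar>rho v (int l)\<bar> = int n"
    using abs_rho[OF vc, of "int l" "rho (inv v) (int n)"] vc by (simp add: l_def)
  have other: "1 \<le> \<bar>rho v (int i)\<bar>" "\<bar>rho v (int i)\<bar> \<le> int (n - 1)" if "1 \<le> i" "i \<le> n" "i \<noteq> l" for i
    using range[OF that(1,2)] abs_rho[OF vc, of "int i" "int l"] vl that(3) by auto
  have un: "\<bar>rho u (int n)\<bar> = \<bar>rho w (int i)\<bar> \<longleftrightarrow> i = l" for i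
  proof -
    have "\<bar>rho u (int n)\<bar> = \<bar>rho w (int i)\<bar> \<longleftrightarrow> \<bar>rho v (int l)\<bar> = \<bar>rho v (int i)\<bar>"
      using vl by (simp only: h abs_rho[OF uc]) simp
    also have "\<dots> \<longleftrightarrow> i = l" by (auto simp: abs_rho[OF vc])
    finally show ?thesis .
  qed
  \<comment> \<open>Before position \<open>l\<close> all values of \<open>v\<close> have absolute
    value at most \<open>n - 1\<close>, the range in which \<open>u\<close> is known to be a
    chain.\<close>
  have chain_eq: "chain (rho v) k \<longleftrightarrow> chain (rho w) k" if "k \<le> l" "k \<le> n" "k < l \<or> k = 0" for k
  proof -
    have "\<bar>rho w (int i)\<bar> < rho w (int i + 1) \<longleftrightarrow> \<bar>rho v (int i)\<bar> < rho v (int i + 1)"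
      if "1 \<le> i" "i < k" for i
      using that other[of i] other[of "Suc i"] \<open>k < l \<or> k = 0\<close> \<open>k \<le> n\<close>
        chain_abs_less_iff[OF odd_rho[OF uc] chu, of "rho v (int i)" "rho v (int i + 1)"]
      by (simp add: h add.commute)
    then show ?thesis by (auto simp: chain_def)
  qed
  have reps: "v \<in> reps k \<longleftrightarrow> chain (rho v) k" "w \<in> reps k \<longleftrightarrow> chain (rho w) k" if "1 \<le> k" "k \<le> n" for k
    using reps_iff that vc w by auto
  let ?R = "(w \<in> reps j \<and> (\<exists>l\<in>{j<..n}. \<bar>rho u (int n)\<bar> = \<bar>rho w (int l)\<bar>)) \<or>
    (rho u (int n) = rho w (int j) \<and> w \<in> reps (j - 1))"
  consider "j < l" | "l = j" | "l < j" by linarith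
  then have "v \<in> reps j \<longleftrightarrow> ?R"
  proof cases
    case 1
    then have "rho u (int n) \<noteq> rho w (int j)" using un[of j] by auto
    then show ?thesis using 1 reps[of j] chain_eq[of j] j l un by auto
  next
    case 2
    define k where "k = j - 1"
    have k: "j = Suc k" "1 \<le> k" "k < l" "k \<le> n" using j 2 by (auto simp: k_def)
    have "\<bar>rho v (int k)\<bar> < int n" using other[of k] k n3 by auto
    moreover have "rho u (int n) = rho w (int j) \<longleftrightarrow> rho v (int j) = int n"
      using h uc by auto
    ultimately have "\<bar>rho v (int k)\<bar> < rho v (int j) \<longleftrightarrow> rho u (int n) = rho w (int j)"
      using vl 2 by auto
    moreover have "chain (rho v) j \<longleftrightarrow> chain (rho v) k \<and> \<bar>rho v (int k)\<bar> < rho v (int j)"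
      using k by (auto simp: chain_def less_Suc_eq add.commute)
    ultimately show ?thesis using 2 reps[of j] reps[of k] chain_eq[of k] j k un by auto
  next
    case 3
    have "\<not> chain (rho v) j"
    proof
      assume "chain (rho v) j"
      then have "\<bar>rho v (int l)\<bar> < rho v (int l + 1)"
        unfolding chain_def by (rule bspec) (use 3 l in simp)
      then have "int n < rho v (int l + 1)" using vl by simp
      then show False using range[of "Suc l"] 3 j by (simp add: add.commute)
    qed
    moreover have "rho u (int n) \<noteq> rho w (int j)" using un[of j] 3 by auto
    moreover have "\<forall>i\<in>{j<..n}. \<bar>rho u (int n)\<bar> \<noteq> \<bar>rho w (int i)\<bar>" using un 3 by simp
    ultimately show ?thesis using reps(1)[of j] j by simp
  qed
  then show ?thesis by (simp add: v_def)
qed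

text \<open>The case \<open>j = n\<close> of the preceding criterion: its second alternative puts
  \<open>inv u \<otimes> v\<close> into \<open>reps n\<close>, which contains only
  \<open>\<one>\<close>.\<close>

lemma reps_pred_inj:
  assumes "u \<in> reps (n - 1)" "v \<in> reps (n - 1)" "rho u (int n) = rho v (int n)"
  shows "u = v"
proof -
  have c: "u \<in> carrier W" "v \<in> carrier W" using assms reps_carrier by auto
  have "inv u \<otimes> v \<in> reps n" using quotient_in_reps_iff[of u v n] assms c n3 by simp
  then show ?thesis using reps_n c by (metis inv_equality inv_inv inv_closed singletonD)
qed

lemma card_abs_in:
  assumes "w \<in> carrier W" "1 \<le> j" "j \<le> n"
  shows "card {c \<in> signed. \<exists>l\<in>{j<..n}. \<bar>c\<bar> = \<bar>rho w (int l)\<bar>} = 2 * (n - j)"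
proof -
  have "{c \<in> signed. \<exists>l\<in>{j<..n}. \<bar>c\<bar> = \<bar>rho w (int l)\<bar>} =
    rho w ` (int ` {j<..n} \<union> (\<lambda>i. - int i) ` {j<..n})" (is "?A = ?B")
  proof
    show "?A \<subseteq> ?B"
    proof
      fix c assume "c \<in> ?A"
      then obtain l where "l \<in> {j<..n}" "c = rho w (int l) \<or> c = rho w (- int l)"
        using rho_minus[OF assms(1)] by (auto simp: abs_eq_iff)
      then show "c \<in> ?B" by blast
    qed
    show "?B \<subseteq> ?A"
    proof
      fix c assume "c \<in> ?B"
      then obtain l where l: "l \<in> {j<..n}" and c: "c = rho w (int l) \<or> c = rho w (- int l)" by blast
      then have "int l \<in> signed" "- int l \<in> signed" by (auto simp: signed_def)
      then have "c \<in> signed" using c rho_signed[OF assms(1)] by blast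
      moreover have "\<bar>c\<bar> = \<bar>rho w (int l)\<bar>" using c rho_minus[OF assms(1)] by auto
      ultimately show "c \<in> ?A" using l by blast
    qed
  qed
  moreover have "card ?B = card (int ` {j<..n} \<union> (\<lambda>i. - int i) ` {j<..n})"
    using assms(1) by (intro card_image inj_onI) simp
  moreover have "\<dots> = card (int ` {j<..n}) + card ((\<lambda>i. - int i) ` {j<..n})"
    by (intro card_Un_disjoint) auto
  moreover have "\<dots> = 2 * (n - j)" by (simp add: card_image inj_on_def)
  ultimately show ?thesis by simp
qed

text \<open>The map sending \<open>u\<close> to the image of \<open>n\<close> identifies
  \<open>reps (n - 1)\<close> with \<open>signed\<close>, so it suffices to count admissible images.
  The two alternatives of \<open>quotient_in_reps_iff\<close> contribute the values
  \<open>\<plusminus>rho w l\<close> with \<open>l > j\<close> and the single value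
  \<open>rho w j\<close>, which are disjoint.\<close>

lemma card_quotient:
  assumes w: "w \<in> carrier W" and j: "2 \<le> j" "j \<le> n"
  shows "card {u \<in> reps (n - 1). inv u \<otimes> w \<in> reps j} =
    (if w \<in> reps j then 2 * (n - j) else 0) + (if w \<in> reps (j - 1) then 1 else 0)"
proof -
  let ?f = "\<lambda>u. rho u (int n)"
  let ?A = "if w \<in> reps j then {c \<in> signed. \<exists>l\<in>{j<..n}. \<bar>c\<bar> = \<bar>rho w (int l)\<bar>} else {}"
  let ?B = "if w \<in> reps (j - 1) then {rho w (int j)} else {}"
  have "bij_betw ?f {u \<in> reps (n - 1). inv u \<otimes> w \<in> reps j} (?A \<union> ?B)"
  proof (rule bij_betw_imageI)
    show "inj_on ?f {u \<in> reps (n - 1). inv u \<otimes> w \<in> reps j}"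
      using reps_pred_inj by (blast intro: inj_onI)
    have sig: "?f u \<in> signed" if "u \<in> reps (n - 1)" for u
      using that reps_carrier[of "n - 1"] n3 rho_signed[of u "int n"] by (auto simp: signed_def)
    have sj: "rho w (int j) \<in> signed" using rho_signed[OF w, of "int j"] j by (auto simp: signed_def)
    show "?f ` {u \<in> reps (n - 1). inv u \<otimes> w \<in> reps j} = ?A \<union> ?B"
    proof
      show "?f ` {u \<in> reps (n - 1). inv u \<otimes> w \<in> reps j} \<subseteq> ?A \<union> ?B"
        using quotient_in_reps_iff[OF _ w j] sig by auto
      show "?A \<union> ?B \<subseteq> ?f ` {u \<in> reps (n - 1). inv u \<otimes> w \<in> reps j}"
      proof
        fix c assume c: "c \<in> ?A \<union> ?B"
        then have "c \<in> signed" using sj by (auto split: if_splits)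
        then obtain u where u: "u \<in> reps (n - 1)" "?f u = c" by (rule reps_pred_exists)
        then have "inv u \<otimes> w \<in> reps j"
          using quotient_in_reps_iff[OF _ w j, of u] c by (auto split: if_splits)
        then show "c \<in> ?f ` {u \<in> reps (n - 1). inv u \<otimes> w \<in> reps j}" using u by blast
      qed
    qed
  qed
  then have "card {u \<in> reps (n - 1). inv u \<otimes> w \<in> reps j} = card (?A \<union> ?B)"
    by (rule bij_betw_same_card)
  also have "\<dots> = card ?A + card ?B"
  proof (rule card_Un_disjoint)
    have "\<bar>rho w (int j)\<bar> \<noteq> \<bar>rho w (int l)\<bar>" if "l \<in> {j<..n}" for l
      using that j by (simp only: abs_eq_iff rho_minus[OF w, symmetric] rho_eq_iff[OF w]) simp
    then show "?A \<inter> ?B = {}" by auto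
  qed (auto simp: finite_signed)
  also have "card ?A = (if w \<in> reps j then 2 * (n - j) else 0)"
    using card_abs_in[OF w, of j] j by simp
  finally show ?thesis by simp
qed

end

section \<open>Polynomial, quotient and generated algebras as records\<close>

lemma poly_algebra_simps [simp]:
  "carrier poly_algebra = UNIV" "p \<otimes>\<^bsub>poly_algebra\<^esub> q = p * q"
  "p \<oplus>\<^bsub>poly_algebra\<^esub> q = p + q" "\<one>\<^bsub>poly_algebra\<^esub> = 1" "\<zero>\<^bsub>poly_algebra\<^esub> = 0"
  "c \<odot>\<^bsub>poly_algebra\<^esub> p = Polynomial.smult c p"
  by (simp_all add: poly_algebra_def ring.defs module.defs ring_of_type_algebra_def)

lemma cring_poly_algebra: "cring poly_algebra"
proof -
  have "\<exists>y. x + y = 0" for x :: "rat poly" using add.right_inverse by blast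
  then show ?thesis
    using add.right_inverse by unfold_locales (auto simp: algebra_simps Units_def)
qed

lemma quotient_algebra_simps [simp]:
  "carrier (quotient_algebra A I) = a_rcosets\<^bsub>A\<^esub> I"
  "C \<otimes>\<^bsub>quotient_algebra A I\<^esub> D = rcoset_mult A I C D"
  "C \<oplus>\<^bsub>quotient_algebra A I\<^esub> D = C <+>\<^bsub>A\<^esub> D"
  "\<one>\<^bsub>quotient_algebra A I\<^esub> = I +>\<^bsub>A\<^esub> \<one>\<^bsub>A\<^esub>"
  "c \<odot>\<^bsub>quotient_algebra A I\<^esub> C = (\<Union>a\<in>C. I +>\<^bsub>A\<^esub> (c \<odot>\<^bsub>A\<^esub> a))"
  by (simp_all add: quotient_algebra_def ring.defs module.defs FactRing_def)

lemma generated_subalgebra_simps [simp]: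
  "x \<otimes>\<^bsub>generated_subalgebra A T\<^esub> y = x \<otimes>\<^bsub>A\<^esub> y"
  "x \<oplus>\<^bsub>generated_subalgebra A T\<^esub> y = x \<oplus>\<^bsub>A\<^esub> y"
  "\<one>\<^bsub>generated_subalgebra A T\<^esub> = \<one>\<^bsub>A\<^esub>"
  "c \<odot>\<^bsub>generated_subalgebra A T\<^esub> x = c \<odot>\<^bsub>A\<^esub> x"
  by (simp_all add: generated_subalgebra_def)

lemma poly_coset: "I +>\<^bsub>poly_algebra\<^esub> p = (\<lambda>h. h + p) ` I"
  by (auto simp: a_r_coset_def r_coset_def)

section \<open>Linear combinations of polynomials\<close>

text \<open>Among the terms with nonzero coefficient one has the largest degree, and no other term
  reaches the coefficient of the sum there.\<close>

lemma distinct_degrees_independent: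
  fixes q :: "'i \<Rightarrow> 'a::field poly"
  assumes "finite I" "inj_on (degree \<circ> q) I" "\<And>i. i \<in> I \<Longrightarrow> q i \<noteq> 0"
    and zero: "(\<Sum>i\<in>I. Polynomial.smult (c i) (q i)) = 0" and "i \<in> I"
  shows "c i = 0"
proof (rule ccontr)
  assume "c i \<noteq> 0"
  define J where "J = {i \<in> I. c i \<noteq> 0}"
  have "finite J" "J \<noteq> {}" using assms \<open>c i \<noteq> 0\<close> by (auto simp: J_def)
  then have "Max ((\<lambda>i. degree (q i)) ` J) \<in> (\<lambda>i. degree (q i)) ` J" by (intro Max_in) auto
  then obtain k where k: "k \<in> J" and "Max ((\<lambda>i. degree (q i)) ` J) = degree (q k)" by auto
  then have max: "degree (q i) \<le> degree (q k)" if "i \<in> J" for i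
    using Max_ge[of "(\<lambda>i. degree (q i)) ` J" "degree (q i)"] that \<open>finite J\<close> by simp
  have "(\<Sum>i\<in>I. c i * coeff (q i) (degree (q k))) = (\<Sum>i\<in>{k}. c i * coeff (q i) (degree (q k)))"
  proof (rule sum.mono_neutral_right)
    show "\<forall>i\<in>I - {k}. c i * coeff (q i) (degree (q k)) = 0"
    proof
      fix i assume i: "i \<in> I - {k}"
      show "c i * coeff (q i) (degree (q k)) = 0"
      proof (cases "c i = 0")
        case False
        then have "degree (q i) \<le> degree (q k)" using i max by (simp add: J_def)
        moreover have "degree (q i) \<noteq> degree (q k)"
          using assms(2) i k by (auto simp: inj_on_def J_def)
        ultimately show ?thesis by (simp add: coeff_eq_0)
      qed simp
    qed
  qed (use assms k J_def in auto)
  moreover have "(\<Sum>i\<in>I. c i * coeff (q i) (degree (q k))) = 0"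
    using arg_cong[OF zero, of "\<lambda>p. coeff p (degree (q k))"] by (simp add: coeff_sum)
  ultimately show False using k assms(3) by (auto simp: J_def)
qed

text \<open>Subtracting a multiple of the last \<open>q\<close> kills the top coefficient. The
  alternative \<open>p = 0\<close> covers \<open>n = 0\<close>, since the zero polynomial has degree
  0.\<close>

lemma poly_as_combination:
  fixes q :: "nat \<Rightarrow> 'a::field poly"
  assumes "\<And>i. i < n \<Longrightarrow> q i \<noteq> 0 \<and> degree (q i) = i" "p = 0 \<or> degree p < n"
  shows "\<exists>c. p = (\<Sum>i<n. Polynomial.smult (c i) (q i))"
  using assms
proof (induct n arbitrary: p)
  case (Suc n)
  define a where "a = coeff p n / lead_coeff (q n)"
  define r where "r = p - Polynomial.smult a (q n)"
  have q: "degree (q n) = n" "q n \<noteq> 0" using Suc.prems(1)[of n] by auto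
  then have lead: "coeff (q n) n \<noteq> 0" by (metis leading_coeff_0_iff)
  have "coeff r m = 0" if "n \<le> m" for m
  proof (cases "m = n")
    case True
    then show ?thesis using q lead by (simp add: r_def a_def)
  next
    case False
    then show ?thesis using q that Suc.prems(2) by (auto simp: r_def coeff_eq_0)
  qed
  then have "r = 0 \<or> degree r < n" by (metis leading_coeff_0_iff not_le)
  then obtain c where "r = (\<Sum>i<n. Polynomial.smult (c i) (q i))"
    using Suc.hyps[of r] Suc.prems(1) by auto
  then have "p = (\<Sum>i<Suc n. Polynomial.smult ((c(n := a)) i) (q i))"
    by (simp add: r_def algebra_simps)
  then show ?case by blast
qed simp

section \<open>Evaluating polynomials in a rational algebra\<close>

locale rat_algebra = ring A for A :: "(rat, 'a) module" (structure) +
  assumes smult_closed [simp]: "x \<in> carrier A \<Longrightarrow> c \<odot> x \<in> carrier A"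
    and smult_add: "x \<in> carrier A \<Longrightarrow> (c + d) \<odot> x = c \<odot> x \<oplus> d \<odot> x"
    and smult_add_right: "x \<in> carrier A \<Longrightarrow> y \<in> carrier A \<Longrightarrow> c \<odot> (x \<oplus> y) = c \<odot> x \<oplus> c \<odot> y"
    and smult_smult: "x \<in> carrier A \<Longrightarrow> c \<odot> (d \<odot> x) = (c * d) \<odot> x"
    and smult_one: "x \<in> carrier A \<Longrightarrow> 1 \<odot> x = x"
    and smult_mult_left: "x \<in> carrier A \<Longrightarrow> y \<in> carrier A \<Longrightarrow> (c \<odot> x) \<otimes> y = c \<odot> (x \<otimes> y)"
    and smult_mult_right: "x \<in> carrier A \<Longrightarrow> y \<in> carrier A \<Longrightarrow> x \<otimes> (c \<odot> y) = c \<odot> (x \<otimes> y)"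
begin

lemma smult_0 [simp]: "x \<in> carrier A \<Longrightarrow> 0 \<odot> x = \<zero>"
  using smult_add[of x 0 0] by simp

lemma smult_zero [simp]: "c \<odot> \<zero> = \<zero>"
  using smult_add_right[of \<zero> \<zero> c] by simp

lemma scalar_mult: "x \<in> carrier A \<Longrightarrow> (c \<odot> \<one>) \<otimes> x = c \<odot> x"
  by (simp add: smult_mult_left)

text \<open>Horner's scheme for substituting \<open>y\<close>, with constants embedded as multiples
  of \<open>\<one>\<close>.\<close>

definition ev :: "'a \<Rightarrow> rat poly \<Rightarrow> 'a" where
  "ev y p = fold_coeffs (\<lambda>c b. c \<odot> \<one> \<oplus> y \<otimes> b) p \<zero>"

lemma ev_0 [simp]: "ev y 0 = \<zero>"
  by (simp add: ev_def)

lemma ev_pCons [simp]: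
  assumes "y \<in> carrier A" shows "ev y (pCons c p) = c \<odot> \<one> \<oplus> y \<otimes> ev y p"
  using assms by (cases "c = 0 \<and> p = 0") (auto simp: ev_def)

lemma ev_closed [simp]: "y \<in> carrier A \<Longrightarrow> ev y p \<in> carrier A"
  by (induct p) auto

lemma ev_1 [simp]: "y \<in> carrier A \<Longrightarrow> ev y 1 = \<one>"
  by (simp add: one_pCons smult_one)

lemma ev_add [simp]: "y \<in> carrier A \<Longrightarrow> ev y (p + q) = ev y p \<oplus> ev y q"
  by (induct p q rule: poly_induct2) (simp_all add: smult_add r_distr a_ac)

lemma ev_smult [simp]: "y \<in> carrier A \<Longrightarrow> ev y (Polynomial.smult c p) = c \<odot> ev y p"
  by (induct p) (simp_all add: smult_add_right smult_smult smult_mult_right)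

lemma ev_mult [simp]: "y \<in> carrier A \<Longrightarrow> ev y (p * q) = ev y p \<otimes> ev y q"
  by (induct p) (simp_all add: l_distr smult_mult_left m_assoc)

lemma ev_power: "y \<in> carrier A \<Longrightarrow> ev y (p ^ k) = ev y p [^] k"
  by (induct k) (simp_all del: power_Suc add: power_Suc2)

lemma ev_minus: "y \<in> carrier A \<Longrightarrow> ev y (- p) = \<ominus> ev y p"
  using ev_add[of y "- p" p] by (intro minus_equality[symmetric]) auto

lemma ev_diff: "y \<in> carrier A \<Longrightarrow> ev y (p - q) = ev y p \<ominus> ev y q"
  using ev_add[of y p "- q"] by (simp add: ev_minus a_minus_def)

lemma ev_eq_iff: "y \<in> carrier A \<Longrightarrow> ev y p = ev y q \<longleftrightarrow> ev y (p - q) = \<zero>"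
  by (simp add: ev_diff)

lemma ev_sum: "finite I \<Longrightarrow> y \<in> carrier A \<Longrightarrow> ev y (\<Sum>i\<in>I. p i) = (\<Oplus>i\<in>I. ev y (p i))"
  by (induct I rule: finite_induct) auto

text \<open>The values of polynomials at \<open>y\<close> form a subalgebra containing
  \<open>c \<odot> y\<close>; conversely a subalgebra containing \<open>c \<odot> y\<close> contains
  \<open>y\<close> once \<open>c\<close> can be inverted. The factor allows for a generator that is
  twice the natural variable.\<close>

lemma generated_subalgebra_eq:
  assumes y: "y \<in> carrier A"
  shows "carrier (generated_subalgebra A {c \<odot> y}) \<subseteq> range (ev y)"
    and "c \<noteq> 0 \<Longrightarrow> range (ev y) \<subseteq> carrier (generated_subalgebra A {c \<odot> y})"
proof -
  have "subring (range (ev y)) A"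
  proof (rule subringI)
    show "\<one> \<in> range (ev y)" using y by (metis ev_1 rangeI)
    show "\<ominus> h \<in> range (ev y)" if "h \<in> range (ev y)" for h
      using that y by (auto simp flip: ev_minus)
    show "h1 \<otimes> h2 \<in> range (ev y)" "h1 \<oplus> h2 \<in> range (ev y)"
      if "h1 \<in> range (ev y)" "h2 \<in> range (ev y)" for h1 h2
      using that y by (auto simp flip: ev_mult ev_add)
  qed (use y in auto)
  moreover have "d \<odot> v \<in> range (ev y)" if "v \<in> range (ev y)" for d v
    using that y by (auto simp flip: ev_smult)
  moreover have "c \<odot> y = ev y [:0, c:]" using y by (simp add: smult_mult_right)
  ultimately show "carrier (generated_subalgebra A {c \<odot> y}) \<subseteq> range (ev y)"
    unfolding generated_subalgebra_def by auto
  assume "c \<noteq> 0"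
  show "range (ev y) \<subseteq> carrier (generated_subalgebra A {c \<odot> y})"
  proof -
    have "ev y p \<in> V" if V: "subring V A" "\<forall>d. \<forall>v\<in>V. d \<odot> v \<in> V" "c \<odot> y \<in> V" for V p
    proof -
      have "y = (1 / c) \<odot> (c \<odot> y)" using y \<open>c \<noteq> 0\<close> by (simp add: smult_smult smult_one)
      then have "y \<in> V" using V by metis
      then show ?thesis
        using V y subringE[OF V(1)] by (induct p) auto
    qed
    then show ?thesis unfolding generated_subalgebra_def by auto
  qed
qed

text \<open>The isomorphism sends an element to its fibre under \<open>ev y\<close>. Fibres are
  cosets of the kernel \<open>I\<close>, so there is no choice of representative, and distinct
  elements have distinct fibres.\<close>

lemma algebra_iso_quotient:
  assumes y: "y \<in> carrier A" and c: "c \<noteq> 0"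
    and I: "ideal I poly_algebra" "I = {p. ev y p = \<zero>}"
  shows "\<exists>\<phi>\<in>algebra_iso (generated_subalgebra A {c \<odot> y}) (quotient_algebra poly_algebra I).
    \<forall>p. \<phi> (ev y p) = I +>\<^bsub>poly_algebra\<^esub> p"
proof -
  let ?P = poly_algebra
  let ?E = "generated_subalgebra A {c \<odot> y}"
  define \<phi> where "\<phi> = (\<lambda>b. {p. ev y p = b})"
  have E: "carrier ?E = range (ev y)" using generated_subalgebra_eq[OF y] c by blast
  have \<phi>: "\<phi> (ev y p) = I +>\<^bsub>?P\<^esub> p" for p
  proof -
    have "q \<in> (\<lambda>h. h + p) ` I \<longleftrightarrow> ev y q = ev y p" for q
    proof -
      have "q \<in> (\<lambda>h. h + p) ` I \<longleftrightarrow> q - p \<in> I"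
        by (auto intro: image_eqI[of _ _ "q - p"])
      then show ?thesis using I(2) ev_eq_iff[OF y] by simp
    qed
    then show ?thesis by (auto simp: \<phi>_def poly_coset)
  qed
  interpret I: ideal I ?P by (rule I(1))
  have "\<phi> \<in> ring_hom ?E (quotient_algebra ?P I)"
  proof (rule ring_hom_memI)
    fix b b' assume "b \<in> carrier ?E" "b' \<in> carrier ?E"
    then obtain p q where b: "b = ev y p" "b' = ev y q" using E by auto
    have "\<phi> (ev y (p * q)) = rcoset_mult ?P I (\<phi> (ev y p)) (\<phi> (ev y q))"
      unfolding \<phi> using I.rcoset_mult_add[of p q] by simp
    then show "\<phi> (b \<otimes>\<^bsub>?E\<^esub> b') = \<phi> b \<otimes>\<^bsub>quotient_algebra ?P I\<^esub> \<phi> b'" using b y by simp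
    have "\<phi> (ev y (p + q)) = \<phi> (ev y p) <+>\<^bsub>?P\<^esub> \<phi> (ev y q)"
      unfolding \<phi> using I.a_rcos_sum[of p q] by simp
    then show "\<phi> (b \<oplus>\<^bsub>?E\<^esub> b') = \<phi> b \<oplus>\<^bsub>quotient_algebra ?P I\<^esub> \<phi> b'" using b y by simp
  next
    fix b assume "b \<in> carrier ?E"
    then show "\<phi> b \<in> carrier (quotient_algebra ?P I)"
      using E \<phi> by (auto simp: A_RCOSETS_def RCOSETS_def a_r_coset_def)
  next
    show "\<phi> \<one>\<^bsub>?E\<^esub> = \<one>\<^bsub>quotient_algebra ?P I\<^esub>" using \<phi>[of 1] y by simp
  qed
  moreover have "bij_betw \<phi> (carrier ?E) (carrier (quotient_algebra ?P I))"
  proof (rule bij_betw_imageI)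
    show "inj_on \<phi> (carrier ?E)" by (rule inj_onI) (auto simp: E \<phi>_def)
    show "\<phi> ` carrier ?E = carrier (quotient_algebra ?P I)"
      using E \<phi> by (auto simp: A_RCOSETS_def RCOSETS_def a_r_coset_def)
  qed
  moreover have "\<phi> (d \<odot>\<^bsub>?E\<^esub> b) = d \<odot>\<^bsub>quotient_algebra ?P I\<^esub> \<phi> b" if "b \<in> carrier ?E" for d b
  proof -
    obtain p where b: "b = ev y p" using \<open>b \<in> carrier ?E\<close> E by auto
    have "I +>\<^bsub>?P\<^esub> Polynomial.smult d q = \<phi> (d \<odot> b)" if "q \<in> \<phi> b" for q
      using that y \<phi>[of "Polynomial.smult d q"] by (simp add: \<phi>_def)
    moreover have "p \<in> \<phi> b" using b by (simp add: \<phi>_def)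
    ultimately show ?thesis by auto
  qed
  ultimately have "\<phi> \<in> algebra_iso ?E (quotient_algebra ?P I)"
    by (simp add: algebra_iso_def ring_iso_def)
  then show ?thesis using \<phi> by blast
qed

text \<open>Ring multiplication by an element of \<open>scalars A\<close> is scalar multiplication.
  Each list head adds one coefficient, which \<open>case_nat\<close> puts in front of the
  others.\<close>

lemma Span_ev:
  assumes y: "y \<in> carrier A"
  shows "Span (scalars A) (map (ev y) ps) =
    range (\<lambda>c. ev y (\<Sum>i<length ps. Polynomial.smult (c i) (ps ! i)))"
proof (induct ps)
  case Nil
  then show ?case by auto
next
  case (Cons p ps)
  let ?comb = "\<lambda>c. \<Sum>i<length ps. Polynomial.smult (c i) (ps ! i)"
  have "Span (scalars A) (map (ev y) (p # ps)) =
    {d \<odot> ev y p \<oplus> b |d b. b \<in> Span (scalars A) (map (ev y) ps)}"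
    using y by (auto simp: line_extension_def set_add_def set_mult_def r_coset_def scalars_def
        scalar_mult)
  also have "\<dots> = {ev y (Polynomial.smult d p + ?comb c) |d c. True}"
    unfolding Cons using y by auto
  also have "\<dots> = range (\<lambda>c. ev y (\<Sum>i<length (p # ps). Polynomial.smult (c i) ((p # ps) ! i)))"
    (is "?L = ?R")
  proof
    show "?R \<subseteq> ?L"
      by (force simp: sum.lessThan_Suc_shift simp del: sum.lessThan_Suc ev_add ev_smult)
    show "?L \<subseteq> ?R"
    proof clarify
      fix d c
      have eq: "Polynomial.smult d p + ?comb c =
        (\<Sum>i<length (p # ps). Polynomial.smult (case_nat d c i) ((p # ps) ! i))"
        by (simp add: sum.lessThan_Suc_shift del: sum.lessThan_Suc)
      show "ev y (Polynomial.smult d p + ?comb c) \<in> ?R"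
        unfolding eq by (rule rangeI[where x = "case_nat d c"])
    qed
  qed
  finally show ?case .
qed

text \<open>If the head lay in the span of the tail, this would be a relation with coefficient -1 at
  the head.\<close>

lemma independent_ev:
  assumes y: "y \<in> carrier A"
    and indep: "\<And>c. ev y (\<Sum>i<length ps. Polynomial.smult (c i) (ps ! i)) = \<zero> \<Longrightarrow>
      \<forall>i<length ps. c i = 0"
  shows "independent (scalars A) (map (ev y) ps)"
  using indep
proof (induct ps)
  case (Cons p ps)
  let ?comb = "\<lambda>c. \<Sum>i<length ps. Polynomial.smult (c i) (ps ! i)"
  have comb: "(\<Sum>i<length (p # ps). Polynomial.smult (case_nat d c i) ((p # ps) ! i)) =
      Polynomial.smult d p + ?comb c" for d c
    by (simp add: sum.lessThan_Suc_shift del: sum.lessThan_Suc)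
  have "ev y p \<notin> Span (scalars A) (map (ev y) ps)"
  proof
    assume "ev y p \<in> Span (scalars A) (map (ev y) ps)"
    then obtain c where "ev y p = ev y (?comb c)" unfolding Span_ev[OF y] by blast
    then have "ev y (?comb c - p) = \<zero>" using ev_eq_iff[OF y] by metis
    moreover have "?comb c - p = Polynomial.smult (- 1) p + ?comb c" by simp
    ultimately have "ev y (Polynomial.smult (- 1) p + ?comb c) = \<zero>" by metis
    then have "\<forall>i<length (p # ps). case_nat (- 1) c i = (0::rat)"
      by (intro Cons.prems) (unfold comb)
    from spec[OF this, of 0] show False by simp
  qed
  moreover have "\<forall>i<length ps. c i = 0" if "ev y (?comb c) = \<zero>" for c
  proof -
    have "ev y (Polynomial.smult 0 p + ?comb c) = \<zero>" using that by simp
    then have "\<forall>i<length (p # ps). case_nat 0 c i = (0::rat)"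
      by (intro Cons.prems) (unfold comb)
    from spec[OF this, of "Suc _"] show ?thesis by simp
  qed
  ultimately show ?case using Cons.hyps y by (auto intro: li_Cons)
qed simp

text \<open>By \<open>inj\<close> and \<open>F\<close>, the polynomial \<open>F\<close> is minimal
  for \<open>y\<close> up to a scalar: evaluation is injective below degree \<open>n\<close>, and
  remainders modulo \<open>F\<close> give every value. The permutation \<open>f\<close> allows the
  list to run through the degrees in any order.\<close>

lemma basis_ev:
  assumes y: "y \<in> carrier A" and c: "c \<noteq> 0"
    and inj: "\<And>p. ev y p = \<zero> \<Longrightarrow> p = 0 \<or> n \<le> degree p"
    and F: "ev y F = \<zero>" "F \<noteq> 0" "degree F = n"
    and q: "\<And>i. i < n \<Longrightarrow> q i \<noteq> 0 \<and> degree (q i) = i"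
    and f: "bij_betw f {..<n} {..<n}"
  shows "basis_in A (carrier (generated_subalgebra A {c \<odot> y})) (map (\<lambda>i. ev y (q (f i))) [0..<n])"
proof -
  let ?ps = "map (\<lambda>i. q (f i)) [0..<n]"
  have sum: "(\<Sum>i<length ?ps. Polynomial.smult (c i) (?ps ! i)) =
    (\<Sum>i<n. Polynomial.smult (c i) (q (f i)))" for c
    by (intro sum.cong) auto
  have fn: "f i < n" if "i < n" for i using f that by (auto simp: bij_betw_def)
  have deg: "p = 0 \<or> degree p < n" if "p = (\<Sum>i<n. Polynomial.smult (c i) (q (f i)))" for p c
  proof (cases "n = 0")
    case False
    have "degree p \<le> n - 1" unfolding that
    proof (rule degree_sum_le)
      fix i assume "i \<in> {..<n}"
      then have "degree (q (f i)) \<le> n - 1" using q[OF fn, of i] fn[of i] by simp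
      then show "degree (Polynomial.smult (c i) (q (f i))) \<le> n - 1"
        using degree_smult_le order.trans by blast
    qed simp
    then show ?thesis using False by linarith
  qed (use that in simp)
  have "independent (scalars A) (map (ev y) ?ps)"
  proof (rule independent_ev[OF y])
    fix c assume "ev y (\<Sum>i<length ?ps. Polynomial.smult (c i) (?ps ! i)) = \<zero>"
    then have "(\<Sum>i<n. Polynomial.smult (c i) (q (f i))) = 0"
      using inj deg[OF refl, of c] unfolding sum by (meson not_le)
    moreover have "inj_on (degree \<circ> (\<lambda>i. q (f i))) {..<n}"
      using f q fn by (auto simp: inj_on_def bij_betw_def)
    ultimately show "\<forall>i<length ?ps. c i = 0"
      using distinct_degrees_independent[of "{..<n}" "\<lambda>i. q (f i)" c] q fn by auto
  qed
  moreover have "Span (scalars A) (map (ev y) ?ps) = range (ev y)"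
  proof
    show "range (ev y) \<subseteq> Span (scalars A) (map (ev y) ?ps)"
    proof clarify
      fix p
      have "ev y p = ev y (p mod F)"
        using ev_add[OF y, of "p div F * F" "p mod F"] y F by simp
      moreover have "p mod F = 0 \<or> degree (p mod F) < n"
        using degree_mod_less[OF F(2), of p] F by simp
      then have "\<exists>c. p mod F = (\<Sum>i<n. Polynomial.smult (c i) (q i))"
        using q by (intro poly_as_combination)
      then obtain c where "p mod F = (\<Sum>i<n. Polynomial.smult (c i) (q i))" ..
      moreover have "\<dots> = (\<Sum>i<n. Polynomial.smult ((c \<circ> f) i) (q (f i)))"
        using sum.reindex_bij_betw[OF f, of "\<lambda>i. Polynomial.smult (c i) (q i)"] by simp
      ultimately have "ev y p = ev y (\<Sum>i<n. Polynomial.smult ((c \<circ> f) i) (q (f i)))" by simp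
      then show "ev y p \<in> Span (scalars A) (map (ev y) ?ps)"
        unfolding Span_ev[OF y] sum by (rule range_eqI[where x = "c \<circ> f"])
    qed
  qed (unfold Span_ev[OF y], auto)
  moreover have "map (ev y) ?ps = map (\<lambda>i. ev y (q (f i))) [0..<n]" by simp
  ultimately show ?thesis using generated_subalgebra_eq[OF y] c unfolding basis_in_def
    by (metis subset_antisym)
qed

end

section \<open>The group algebra of a finite group\<close>

locale finite_group = group G for G (structure) +
  assumes finite_carrier: "finite (carrier G)"
begin

abbreviation alg where "alg \<equiv> group_algebra G"

lemma group_algebra_simps [simp]:
  "(f \<oplus>\<^bsub>alg\<^esub> g) w = f w + g w" "\<zero>\<^bsub>alg\<^esub> w = 0"
  "\<one>\<^bsub>alg\<^esub> w = (if w = \<one> then 1 else 0)" "(c \<odot>\<^bsub>alg\<^esub> f) w = c * f w"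
  by (simp_all add: group_algebra_def)

lemma mem_group_algebra: "f \<in> carrier alg \<longleftrightarrow> (\<forall>w. w \<notin> carrier G \<longrightarrow> f w = 0)"
  using finite_carrier by (auto simp: group_algebra_def intro: finite_subset)

lemma left_mult_bij:
  assumes "x \<in> carrier G" shows "bij_betw (\<lambda>z. x \<otimes> z) (carrier G) (carrier G)"
proof (rule bij_betw_byWitness[where f' = "\<lambda>z. inv x \<otimes> z"])
  show "\<forall>a\<in>carrier G. inv x \<otimes> (x \<otimes> a) = a" "\<forall>a\<in>carrier G. x \<otimes> (inv x \<otimes> a) = a"
    using assms by (simp_all flip: m_assoc)
qed (use assms in auto)

text \<open>Once \<open>u\<close> is fixed, only \<open>v = inv u \<otimes> w\<close> can contribute
  to the inner sum, and as the group is finite the outer sum may run over all of it.\<close>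

lemma convolution:
  assumes f: "f \<in> carrier alg" and g: "g \<in> carrier alg"
  shows "(f \<otimes>\<^bsub>alg\<^esub> g) w =
    (if w \<in> carrier G then \<Sum>u\<in>carrier G. f u * g (inv u \<otimes> w) else 0)"
proof -
  have supp: "{u. f u \<noteq> 0} \<subseteq> carrier G" using f by (auto simp: mem_group_algebra)
  have inner: "(\<Sum>v | g v \<noteq> 0 \<and> u \<otimes> v = w. f u * g v) =
      (if w \<in> carrier G then f u * g (inv u \<otimes> w) else 0)" if u: "u \<in> carrier G" for u
  proof -
    have "{v. g v \<noteq> 0 \<and> u \<otimes> v = w} =
        (if w \<in> carrier G \<and> g (inv u \<otimes> w) \<noteq> 0 then {inv u \<otimes> w} else {})"
    proof (rule Set.set_eqI)
      fix v
      show "v \<in> {v. g v \<noteq> 0 \<and> u \<otimes> v = w} \<longleftrightarrow>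
          v \<in> (if w \<in> carrier G \<and> g (inv u \<otimes> w) \<noteq> 0 then {inv u \<otimes> w} else {})"
      proof (cases "v \<in> carrier G")
        case True
        then show ?thesis using u by (auto simp flip: m_assoc)
      next
        case False
        then have "g v = 0" using g by (simp add: mem_group_algebra)
        then show ?thesis using False u by auto
      qed
    qed
    then show ?thesis by simp
  qed
  have "(f \<otimes>\<^bsub>alg\<^esub> g) w = (\<Sum>u | f u \<noteq> 0. \<Sum>v | g v \<noteq> 0 \<and> u \<otimes> v = w. f u * g v)"
    by (simp add: group_algebra_def)
  also have "\<dots> = (\<Sum>u\<in>carrier G. \<Sum>v | g v \<noteq> 0 \<and> u \<otimes> v = w. f u * g v)"
    using supp finite_carrier by (intro sum.mono_neutral_left) auto
  also have "\<dots> = (\<Sum>u\<in>carrier G. if w \<in> carrier G then f u * g (inv u \<otimes> w) else 0)"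
    using inner by (intro sum.cong) auto
  finally show ?thesis by simp
qed

lemma convolution_closed: "f \<in> carrier alg \<Longrightarrow> g \<in> carrier alg \<Longrightarrow> f \<otimes>\<^bsub>alg\<^esub> g \<in> carrier alg"
  using convolution[of f g] by (subst mem_group_algebra) simp

lemma convolution_assoc:
  assumes f: "f \<in> carrier alg" and g: "g \<in> carrier alg" and h: "h \<in> carrier alg"
  shows "(f \<otimes>\<^bsub>alg\<^esub> g) \<otimes>\<^bsub>alg\<^esub> h = f \<otimes>\<^bsub>alg\<^esub> (g \<otimes>\<^bsub>alg\<^esub> h)"
proof
  fix w
  note closed = convolution_closed[OF f g] convolution_closed[OF g h]
  show "((f \<otimes>\<^bsub>alg\<^esub> g) \<otimes>\<^bsub>alg\<^esub> h) w = (f \<otimes>\<^bsub>alg\<^esub> (g \<otimes>\<^bsub>alg\<^esub> h)) w"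
  proof (cases "w \<in> carrier G")
    case True
    have "((f \<otimes>\<^bsub>alg\<^esub> g) \<otimes>\<^bsub>alg\<^esub> h) w =
        (\<Sum>u\<in>carrier G. \<Sum>x\<in>carrier G. f x * g (inv x \<otimes> u) * h (inv u \<otimes> w))"
      using True by (simp add: convolution[OF closed(1) h] convolution[OF f g] sum_distrib_right)
    also have "\<dots> = (\<Sum>x\<in>carrier G. \<Sum>u\<in>carrier G. f x * g (inv x \<otimes> u) * h (inv u \<otimes> w))"
      by (rule sum.swap)
    \<comment> \<open>Substitution \<open>u = x \<otimes> z\<close>.\<close>
    also have "\<dots> = (\<Sum>x\<in>carrier G. \<Sum>z\<in>carrier G. f x * (g z * h (inv z \<otimes> (inv x \<otimes> w))))"
    proof (rule sum.cong[OF refl])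
      fix x assume x: "x \<in> carrier G"
      have "(\<Sum>u\<in>carrier G. f x * g (inv x \<otimes> u) * h (inv u \<otimes> w)) =
          (\<Sum>z\<in>carrier G. f x * g (inv x \<otimes> (x \<otimes> z)) * h (inv (x \<otimes> z) \<otimes> w))"
        by (rule sum.reindex_bij_betw[OF left_mult_bij[OF x], symmetric])
      also have "\<dots> = (\<Sum>z\<in>carrier G. f x * (g z * h (inv z \<otimes> (inv x \<otimes> w))))"
      proof (rule sum.cong[OF refl])
        fix z assume z: "z \<in> carrier G"
        have "inv x \<otimes> (x \<otimes> z) = z" using x z by (simp flip: m_assoc)
        moreover have "inv (x \<otimes> z) \<otimes> w = inv z \<otimes> (inv x \<otimes> w)"
          using x z True by (simp add: inv_mult_group m_assoc)
        ultimately show "f x * g (inv x \<otimes> (x \<otimes> z)) * h (inv (x \<otimes> z) \<otimes> w) =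
            f x * (g z * h (inv z \<otimes> (inv x \<otimes> w)))" by simp
      qed
      finally show "(\<Sum>u\<in>carrier G. f x * g (inv x \<otimes> u) * h (inv u \<otimes> w)) =
          (\<Sum>z\<in>carrier G. f x * (g z * h (inv z \<otimes> (inv x \<otimes> w))))" .
    qed
    also have "\<dots> = (f \<otimes>\<^bsub>alg\<^esub> (g \<otimes>\<^bsub>alg\<^esub> h)) w"
      using True by (simp add: convolution[OF f closed(2)] convolution[OF g h] sum_distrib_left)
    finally show ?thesis .
  qed (simp add: convolution closed f h)
qed

lemma one_convolution:
  assumes "f \<in> carrier alg" shows "\<one>\<^bsub>alg\<^esub> \<otimes>\<^bsub>alg\<^esub> f = f" "f \<otimes>\<^bsub>alg\<^esub> \<one>\<^bsub>alg\<^esub> = f"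
proof -
  have one: "\<one>\<^bsub>alg\<^esub> \<in> carrier alg" by (auto simp: mem_group_algebra)
  have "(\<one>\<^bsub>alg\<^esub> \<otimes>\<^bsub>alg\<^esub> f) w = f w \<and> (f \<otimes>\<^bsub>alg\<^esub> \<one>\<^bsub>alg\<^esub>) w = f w" for w
  proof (cases "w \<in> carrier G")
    case True
    have "(\<one>\<^bsub>alg\<^esub> \<otimes>\<^bsub>alg\<^esub> f) w = (\<Sum>u\<in>carrier G. if u = \<one> then f w else 0)"
      using True by (simp add: convolution one assms) (intro sum.cong; simp)
    moreover have "(f \<otimes>\<^bsub>alg\<^esub> \<one>\<^bsub>alg\<^esub>) w = (\<Sum>u\<in>carrier G. if u = w then f w else 0)"
    proof -
      have "inv u \<otimes> w = \<one> \<longleftrightarrow> u = w" if "u \<in> carrier G" for u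
        using that True by (metis inv_equality inv_inv inv_closed l_inv)
      then show ?thesis using True
        by (simp add: convolution one assms) (intro sum.cong; simp)
    qed
    ultimately show ?thesis using True finite_carrier by simp
  next
    case False
    then show ?thesis using assms by (simp add: convolution one mem_group_algebra[of f])
  qed
  then show "\<one>\<^bsub>alg\<^esub> \<otimes>\<^bsub>alg\<^esub> f = f" "f \<otimes>\<^bsub>alg\<^esub> \<one>\<^bsub>alg\<^esub> = f" by auto
qed

lemma rat_algebra_group_algebra: "rat_algebra alg"
proof -
  have "abelian_group alg"
  proof (rule abelian_groupI)
    fix f assume "f \<in> carrier alg"
    then show "\<exists>g\<in>carrier alg. g \<oplus>\<^bsub>alg\<^esub> f = \<zero>\<^bsub>alg\<^esub>"
      by (intro bexI[of _ "\<lambda>w. - f w"]) (auto simp: mem_group_algebra)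
  qed (auto simp: mem_group_algebra)
  moreover have "Group.monoid alg"
    by (rule monoidI)
      (simp_all add: convolution_closed convolution_assoc one_convolution,
        simp add: mem_group_algebra)
  moreover have closed: "f \<oplus>\<^bsub>alg\<^esub> g \<in> carrier alg" "c \<odot>\<^bsub>alg\<^esub> f \<in> carrier alg"
    if "f \<in> carrier alg" "g \<in> carrier alg" for f g c
    using that by (simp_all add: mem_group_algebra)
  ultimately have "ring alg"
    by (intro ringI)
      (simp_all add: fun_eq_iff convolution algebra_simps sum.distrib)
  then show ?thesis
    by (rule rat_algebra.intro, unfold_locales)
      (use closed in \<open>simp_all add: fun_eq_iff convolution algebra_simps sum_distrib_left
        mult.left_commute\<close>)
qed

sublocale alg: rat_algebra alg by (rule rat_algebra_group_algebra)

lemma finsum_apply: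
  assumes "finite I" "\<And>i. i \<in> I \<Longrightarrow> f i \<in> carrier alg"
  shows "(\<Oplus>\<^bsub>alg\<^esub>i\<in>I. f i) w = (\<Sum>i\<in>I. f i w)"
  using assms by (induct I rule: finite_induct) (auto simp: alg.finsum_insert Pi_def)

lemma sum_group_elem:
  assumes "B \<subseteq> carrier G"
  shows "(\<Oplus>\<^bsub>alg\<^esub>w\<in>B. group_elem w) = (\<lambda>w. if w \<in> B then 1 else 0)"
proof
  fix v
  have "finite B" using assms finite_carrier finite_subset by blast
  then show "(\<Oplus>\<^bsub>alg\<^esub>w\<in>B. group_elem w) v = (if v \<in> B then 1 else 0)"
    using assms by (subst finsum_apply) (auto simp: mem_group_algebra group_elem_def)
qed

end

section \<open>Falling powers\<close>

lemma falling_power_0 [simp]: "falling_power x 0 = 1"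
  by (simp add: falling_power_def)

lemma falling_power_Suc: "falling_power x (Suc k) = (x - of_nat k) * falling_power x k"
  by (simp add: falling_power_def mult.commute)

lemma falling_power_pochhammer: "falling_power x k = (-1) ^ k * pochhammer (- x) k"
  by (induct k) (simp_all add: falling_power_Suc pochhammer_Suc algebra_simps)

text \<open>The unsigned Stirling numbers expand the rising factorial of \<open>- x\<close>.
  Splitting \<open>(-2) ^ k\<close> as \<open>(-2) ^ (k - m) * (-2) ^ m\<close> turns the powers of
  \<open>- x\<close> into powers of \<open>2 * x\<close>.\<close>

lemma falling_power_stirling:
  "2 ^ k * falling_power x k = (\<Sum>m\<in>{0..k}. (-2) ^ (k - m) * of_nat (stirling k m) * (2 * x) ^ m)"
proof -
  have "2 ^ k * falling_power x k = (-2) ^ k * (\<Sum>m\<le>k. of_nat (stirling k m) * (- x) ^ m)"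
    by (simp add: falling_power_pochhammer flip: stirling_pochhammer power_mult_distrib mult.assoc)
  also have "\<dots> = (\<Sum>m\<le>k. (-2) ^ (k - m) * of_nat (stirling k m) * (2 * x) ^ m)"
    unfolding sum_distrib_left
  proof (rule sum.cong[OF refl])
    fix m assume "m \<in> {..k}"
    then have "(-2 :: 'a) ^ k = (-2) ^ (k - m) * (-2) ^ m" by (simp flip: power_add)
    moreover have "(2 * x) ^ m = (-2) ^ m * (- x) ^ m"
      by (simp only: power_mult_distrib[symmetric] minus_mult_minus)
    ultimately show "(-2) ^ k * (of_nat (stirling k m) * (- x) ^ m) =
        (-2) ^ (k - m) * of_nat (stirling k m) * (2 * x) ^ m" by (simp only: mult_ac)
  qed
  finally show ?thesis by (simp add: atMost_atLeast0)
qed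

text \<open>Multiplication by \<open>x\<close> takes the \<open>m\<close>-th falling power to the
  next one plus \<open>m\<close> times itself, which matches the recurrence of the Stirling numbers
  of the second kind.\<close>

lemma power_eq_sum_falling_power: "x ^ k = (\<Sum>m\<le>k. of_nat (Stirling k m) * falling_power x m)"
proof (induct k)
  case (Suc k)
  let ?f = "falling_power x"
  \<comment> \<open>The term at 0 vanishes through its factor \<open>m\<close>, and the one at
    \<open>Suc k\<close> because \<open>Stirling k (Suc k) = 0\<close>.\<close>
  have shift: "(\<Sum>m\<le>k. of_nat m * of_nat (Stirling k m) * ?f m) =
      (\<Sum>m\<le>k. of_nat (Suc m) * of_nat (Stirling k (Suc m)) * ?f (Suc m))"
  proof -
    have "(\<Sum>m\<le>k. of_nat m * of_nat (Stirling k m) * ?f m) =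
        (\<Sum>m\<le>Suc k. of_nat m * of_nat (Stirling k m) * ?f m)" by simp
    also have "\<dots> = (\<Sum>m\<le>k. of_nat (Suc m) * of_nat (Stirling k (Suc m)) * ?f (Suc m))"
      by (subst sum.atMost_Suc_shift) simp
    finally show ?thesis .
  qed
  have "x ^ Suc k = (\<Sum>m\<le>k. of_nat (Stirling k m) * (x * ?f m))"
    by (simp add: Suc sum_distrib_left mult.left_commute)
  also have "\<dots> = (\<Sum>m\<le>k. of_nat (Stirling k m) * ?f (Suc m)) +
      (\<Sum>m\<le>k. of_nat m * of_nat (Stirling k m) * ?f m)"
    by (simp add: falling_power_Suc algebra_simps flip: sum.distrib)
  also have "\<dots> = (\<Sum>m\<le>k. of_nat (Stirling (Suc k) (Suc m)) * ?f (Suc m))"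
    unfolding shift by (simp add: algebra_simps flip: sum.distrib)
  also have "\<dots> = (\<Sum>m\<le>Suc k. of_nat (Stirling (Suc k) m) * ?f m)"
    by (subst sum.atMost_Suc_shift) simp
  finally show ?case .
qed simp

lemma power_Stirling:
  "(2 * x) ^ k = (\<Sum>m\<in>{0..k}. of_nat (Stirling k m) * 2 ^ (k - m) * (2 ^ m * falling_power x m))"
proof -
  have "(2 * x) ^ k = (\<Sum>m\<le>k. of_nat (Stirling k m) * 2 ^ k * falling_power x m)"
    by (simp add: power_mult_distrib power_eq_sum_falling_power[of x k] sum_distrib_left mult_ac)
  also have "\<dots> = (\<Sum>m\<le>k. of_nat (Stirling k m) * 2 ^ (k - m) * (2 ^ m * falling_power x m))"
  proof (rule sum.cong[OF refl])
    fix m assume "m \<in> {..k}"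
    then have "(2 :: 'a) ^ k = 2 ^ (k - m) * 2 ^ m" by (simp flip: power_add)
    then show "of_nat (Stirling k m) * 2 ^ k * falling_power x m =
        of_nat (Stirling k m) * 2 ^ (k - m) * (2 ^ m * falling_power x m)" by (simp only: mult_ac)
  qed
  finally show ?thesis by (simp add: atMost_atLeast0)
qed

lemma degree_falling_power:
  "falling_power [:0, 1::rat:] k \<noteq> 0" "degree (falling_power [:0, 1::rat:] k) = k"
proof (induct k)
  case (Suc k)
  have "[:0, 1:] - of_nat k = [:- of_nat k, 1::rat:]" by (simp add: of_nat_poly)
  then have eq: "falling_power [:0, 1::rat:] (Suc k) = [:- of_nat k, 1:] * falling_power [:0, 1:] k"
    by (simp only: falling_power_Suc)
  have lin: "[:- of_nat k, 1::rat:] \<noteq> 0" "degree [:- of_nat k, 1::rat:] = 1" by simp_all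
  case 1
  show ?case unfolding eq using Suc(1) lin(1) by (metis mult_eq_0_iff)
  case 2
  show ?case unfolding eq degree_mult_eq[OF lin(1) Suc(1)] using Suc(2) lin(2) by simp
qed simp_all

section \<open>The elements \<open>x\<^sub>j\<close>\<close>

text \<open>Turns scalar multiples into products with constant polynomials, the form in which the
  ring identities for falling powers apply.\<close>

lemma poly_coeff_eqs:
  "Polynomial.smult (2 ^ k) p = 2 ^ k * p"
  "Polynomial.smult ((-2) ^ j * of_nat a) p = (-2) ^ j * of_nat a * p"
  "Polynomial.smult (of_nat a * 2 ^ j) p = of_nat a * 2 ^ j * p"
  "[:0, 2:] = 2 * [:0, 1::rat:]"
  for p :: "rat poly"
proof -
  have smult: "Polynomial.smult c p = [:c:] * p" for c by simp
  have two: "[:2::rat:] = 2" "[:-2::rat:] = -2" by (simp_all add: numeral_poly)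
  have pow: "[:c ^ i:] = [:c:] ^ i" for c :: rat and i by (simp add: poly_const_pow)
  have mult: "[:c * d:] = [:c:] * [:d:]" for c d :: rat by simp
  show "Polynomial.smult (2 ^ k) p = 2 ^ k * p"
    "Polynomial.smult ((-2) ^ j * of_nat a) p = (-2) ^ j * of_nat a * p"
    "Polynomial.smult (of_nat a * 2 ^ j) p = of_nat a * 2 ^ j * p"
    by (simp_all only: smult mult pow two of_nat_poly)
  show "[:0, 2:] = 2 * [:0, 1::rat:]" by (simp add: numeral_poly)
qed

context coxeter_D
begin

sublocale finite_group W
  by unfold_locales (rule finite_W)

abbreviation x :: "nat \<Rightarrow> 'w \<Rightarrow> rat" where "x \<equiv> x_elem W S s"

lemma x_eq: "x j = (\<lambda>w. if w \<in> reps j then 1 else 0)"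
  unfolding x_elem_def x_set_def reps_def[symmetric] by (rule sum_group_elem[OF reps_carrier])

lemma x_apply: "x j w = (if w \<in> reps j then 1 else 0)"
  by (simp add: x_eq)

lemma x_closed [simp]: "x j \<in> carrier alg"
  using reps_carrier by (auto simp: mem_group_algebra x_eq)

lemma x_mult_apply:
  assumes "w \<in> carrier W"
  shows "(x (n - 1) \<otimes>\<^bsub>alg\<^esub> x j) w = of_nat (card {u \<in> reps (n - 1). inv u \<otimes> w \<in> reps j})"
proof -
  have "(x (n - 1) \<otimes>\<^bsub>alg\<^esub> x j) w =
      (\<Sum>u\<in>carrier W. if u \<in> reps (n - 1) \<and> inv u \<otimes> w \<in> reps j then 1 else 0)"
    using assms by (simp add: convolution x_apply) (intro sum.cong; simp)
  also have "\<dots> = of_nat (card (carrier W \<inter> {u. u \<in> reps (n - 1) \<and> inv u \<otimes> w \<in> reps j}))"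
    using finite_carrier by (subst sum.inter_filter[symmetric]) (simp_all add: Int_def)
  also have "carrier W \<inter> {u. u \<in> reps (n - 1) \<and> inv u \<otimes> w \<in> reps j} =
      {u \<in> reps (n - 1). inv u \<otimes> w \<in> reps j}"
    using reps_carrier by blast
  finally show ?thesis .
qed

lemma x_mult:
  assumes "2 \<le> j" "j \<le> n"
  shows "x (n - 1) \<otimes>\<^bsub>alg\<^esub> x j = of_nat (2 * (n - j)) \<odot>\<^bsub>alg\<^esub> x j \<oplus>\<^bsub>alg\<^esub> x (j - 1)"
proof
  fix w
  show "(x (n - 1) \<otimes>\<^bsub>alg\<^esub> x j) w =
      (of_nat (2 * (n - j)) \<odot>\<^bsub>alg\<^esub> x j \<oplus>\<^bsub>alg\<^esub> x (j - 1)) w"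
  proof (cases "w \<in> carrier W")
    case True
    then show ?thesis using card_quotient[OF True assms] x_mult_apply[OF True]
      by (simp add: x_apply)
  next
    case False
    then have "w \<notin> reps j" "w \<notin> reps (j - 1)" using reps_carrier by auto
    then show ?thesis using False by (simp add: convolution x_apply)
  qed
qed

lemma card_reps_pred: "card (reps (n - 1)) = 2 * n"
proof -
  have "bij_betw (\<lambda>u. rho u (int n)) (reps (n - 1)) signed"
  proof (rule bij_betw_imageI)
    show "inj_on (\<lambda>u. rho u (int n)) (reps (n - 1))"
      using reps_pred_inj by (blast intro: inj_onI)
    have "int n \<in> signed" using n3 by (simp add: signed_def)
    then have "rho u (int n) \<in> signed" if "u \<in> reps (n - 1)" for u
      using that reps_carrier rho_signed by blast
    moreover have "c \<in> (\<lambda>u. rho u (int n)) ` reps (n - 1)" if "c \<in> signed" for c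
      using that by (rule reps_pred_exists) auto
    ultimately show "(\<lambda>u. rho u (int n)) ` reps (n - 1) = signed" by blast
  qed
  then have "card (reps (n - 1)) = card signed" by (rule bij_betw_same_card)
  then show ?thesis by (simp add: signed_def)
qed

text \<open>Every group element fixes the sum of all elements under left multiplication, so the
  factor is the number of summands of \<open>x (n - 1)\<close>.\<close>

lemma x_mult_1: "x (n - 1) \<otimes>\<^bsub>alg\<^esub> x 1 = of_nat (2 * n) \<odot>\<^bsub>alg\<^esub> x 1"
proof
  fix w
  show "(x (n - 1) \<otimes>\<^bsub>alg\<^esub> x 1) w = (of_nat (2 * n) \<odot>\<^bsub>alg\<^esub> x 1) w"
  proof (cases "w \<in> carrier W")
    case True
    then have "{u \<in> reps (n - 1). inv u \<otimes> w \<in> reps 1} = reps (n - 1)"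
      using reps_carrier unfolding reps_1 by auto
    then show ?thesis using True x_mult_apply[OF True, of 1] card_reps_pred reps_1
      by (simp add: x_apply del: One_nat_def)
  qed (simp add: convolution x_apply reps_1 del: One_nat_def)
qed

lemma x_n: "x n = \<one>\<^bsub>alg\<^esub>"
  by (auto simp: x_eq reps_n)

text \<open>The sets \<open>reps (n - i)\<close> grow strictly with \<open>i\<close>. An element in
  the set for \<open>d\<close> but not in the one before is \<open>s (n - d + 1)\<close>, or
  \<open>\<one>\<close> when \<open>d = 0\<close>.\<close>

lemma separating_element:
  assumes "d < n"
  obtains w where "\<forall>i<n. x (n - i) w = (if d \<le> i then 1 else 0)"
proof (cases "d = 0")
  case True
  then show ?thesis using that[of \<one>] one_in_reps by (simp add: x_eq)
next
  case False
  define j where "j = n - d + 1"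
  have j: "2 \<le> j" "j \<le> n" using assms False by (auto simp: j_def)
  have "x (n - i) (s j) = (if d \<le> i then 1 else 0)" if "i < n" for i
  proof (cases "d \<le> i")
    case True
    then have "reps (j - 1) \<subseteq> reps (n - i)" using that assms j by (intro reps_antimono) (auto simp: j_def)
    then show ?thesis using gen_in_reps(1)[OF j] True by (auto simp: x_eq)
  next
    case False
    then have "reps (n - i) \<subseteq> reps j" using that assms j by (intro reps_antimono) (auto simp: j_def)
    then show ?thesis using gen_in_reps(2)[OF j] False by (auto simp: x_eq)
  qed
  then show ?thesis using that by blast
qed

text \<open>The counterpart of the coset of the variable itself: falling powers are taken of this
  element, whence the factor 2 in the image of \<open>x (n - 1)\<close>.\<close>

definition half_x :: "'w \<Rightarrow> rat" where "half_x = (1 / 2) \<odot>\<^bsub>alg\<^esub> x (n - 1)"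

lemma half_x_closed [simp]: "half_x \<in> carrier alg"
  by (simp add: half_x_def)

lemma smult_2_half_x: "2 \<odot>\<^bsub>alg\<^esub> half_x = x (n - 1)"
  by (simp add: half_x_def alg.smult_smult alg.smult_one)

section \<open>Polynomials in \<open>half_x\<close> and the relations among them\<close>

abbreviation fall :: "nat \<Rightarrow> rat poly" where "fall \<equiv> falling_power [:0, 1:]"

lemma ev_linear: "alg.ev half_x [:c, 2:] = c \<odot>\<^bsub>alg\<^esub> \<one>\<^bsub>alg\<^esub> \<oplus>\<^bsub>alg\<^esub> x (n - 1)"
  by (simp add: alg.smult_mult_right smult_2_half_x)

lemma scaled_fall_Suc: "Polynomial.smult (2 ^ Suc k) (fall (Suc k)) =
    [:- of_nat (2 * k), 2:] * Polynomial.smult (2 ^ k) (fall k)"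
proof -
  have "[:- of_nat (2 * k), 2::rat:] = Polynomial.smult 2 ([:0, 1:] - of_nat k)"
    by (simp add: of_nat_poly)
  then show ?thesis
    by (simp only: falling_power_Suc mult_smult_left mult_smult_right smult_smult power_Suc mult.commute)
qed

text \<open>The step is \<open>x_mult\<close> at \<open>j = n - k\<close>, read as:
  \<open>x (n - 1)\<close> minus \<open>2 * k\<close>, times \<open>x (n - k)\<close>, is
  \<open>x (n - Suc k)\<close>. The bound on \<open>k\<close> keeps \<open>j\<close> at least
  2.\<close>

lemma ev_fall:
  "k \<le> n - 1 \<Longrightarrow> alg.ev half_x (Polynomial.smult (2 ^ k) (fall k)) = x (n - k)"
proof (induct k)
  case 0
  then show ?case using x_n by (simp add: alg.smult_one)
next
  case (Suc k)
  let ?c = "of_nat (2 * k) :: rat"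
  have IH: "alg.ev half_x (Polynomial.smult (2 ^ k) (fall k)) = x (n - k)" using Suc by linarith
  have k: "n - (n - k) = k" "2 \<le> n - k" using Suc.prems n3 by auto
  have "alg.ev half_x (Polynomial.smult (2 ^ Suc k) (fall (Suc k))) =
      alg.ev half_x [:- ?c, 2:] \<otimes>\<^bsub>alg\<^esub> x (n - k)"
    unfolding scaled_fall_Suc alg.ev_mult[OF half_x_closed] IH by (rule refl)
  also have "\<dots> = (- ?c) \<odot>\<^bsub>alg\<^esub> x (n - k) \<oplus>\<^bsub>alg\<^esub> x (n - 1) \<otimes>\<^bsub>alg\<^esub> x (n - k)"
    unfolding ev_linear by (simp add: alg.l_distr alg.scalar_mult)
  also have "\<dots> = x (n - Suc k)"
    unfolding x_mult[OF k(2) diff_le_self] k(1) by (simp add: fun_eq_iff)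
  finally show ?case .
qed

definition rel :: "rat poly" where "rel = fall n - fall (n - 1)"

lemma rel_eq: "rel = [:- of_nat n, 1:] * fall (n - 1)"
proof -
  have "fall n = ([:0, 1:] - of_nat (n - 1)) * fall (n - 1)"
    using falling_power_Suc[of "[:0, 1:]" "n - 1"] n3 by simp
  then have "rel = ([:0, 1:] - of_nat (n - 1) - 1) * fall (n - 1)"
    unfolding rel_def by (simp only: left_diff_distrib mult_1)
  moreover have "[:0, 1:] - of_nat (n - 1) - 1 = [:- of_nat n, 1::rat:]"
    using n3 by (simp add: of_nat_poly one_pCons of_nat_diff)
  ultimately show ?thesis by simp
qed

lemma rel_degree: "rel \<noteq> 0" "degree rel = n"
proof -
  have lin: "[:- of_nat n, 1::rat:] \<noteq> 0" "degree [:- of_nat n, 1::rat:] = 1" by simp_all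
  show "rel \<noteq> 0" unfolding rel_eq using lin(1) degree_falling_power(1) by (metis mult_eq_0_iff)
  show "degree rel = n"
    unfolding rel_eq degree_mult_eq[OF lin(1) degree_falling_power(1)] degree_falling_power(2) lin(2)
    using n3 by simp
qed

text \<open>As \<open>rel\<close> is the linear factor with root \<open>n\<close> times
  \<open>fall (n - 1)\<close>, its multiple by \<open>2 ^ n\<close> evaluates to
  \<open>x (n - 1)\<close> minus \<open>2 * n\<close>, times \<open>x 1\<close>. This is zero by
  \<open>x_mult_1\<close>.\<close>

lemma ev_rel: "alg.ev half_x rel = \<zero>\<^bsub>alg\<^esub>"
proof -
  have eq: "Polynomial.smult (2 ^ n) rel =
      [:- of_nat (2 * n), 2:] * Polynomial.smult (2 ^ (n - 1)) (fall (n - 1))"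
  proof -
    have "(2 :: rat) ^ n = 2 * 2 ^ (n - 1)" using n3 by (simp flip: power_Suc)
    moreover have "[:- of_nat (2 * n), 2::rat:] = Polynomial.smult 2 [:- of_nat n, 1:]" by simp
    ultimately show ?thesis unfolding rel_eq
      by (simp only: mult_smult_left mult_smult_right smult_smult mult.commute)
  qed
  have "n - (n - 1) = 1" using n3 by simp
  with ev_fall[OF order.refl]
  have last: "alg.ev half_x (Polynomial.smult (2 ^ (n - 1)) (fall (n - 1))) = x 1" by metis
  have "alg.ev half_x (Polynomial.smult (2 ^ n) rel) = alg.ev half_x [:- of_nat (2 * n), 2:] \<otimes>\<^bsub>alg\<^esub> x 1"
    unfolding eq alg.ev_mult[OF half_x_closed] last by (rule refl)
  also have "\<dots> = (- of_nat (2 * n)) \<odot>\<^bsub>alg\<^esub> x 1 \<oplus>\<^bsub>alg\<^esub> of_nat (2 * n) \<odot>\<^bsub>alg\<^esub> x 1"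
    unfolding ev_linear x_mult_1[symmetric] by (simp add: alg.l_distr alg.scalar_mult del: One_nat_def)
  finally have "2 ^ n \<odot>\<^bsub>alg\<^esub> alg.ev half_x rel = \<zero>\<^bsub>alg\<^esub>" by (simp add: fun_eq_iff)
  then show ?thesis by (simp add: fun_eq_iff)
qed

text \<open>In the scaled falling powers, a polynomial of degree below \<open>n\<close> evaluates to
  a combination of the \<open>x (n - i)\<close>. Reading it off at the separating element for
  \<open>d\<close> gives the sum of the coefficients from \<open>d\<close> on; differences of
  consecutive tails isolate each coefficient.\<close>

lemma ev_inj:
  assumes "alg.ev half_x p = \<zero>\<^bsub>alg\<^esub>" shows "p = 0 \<or> n \<le> degree p"
proof (rule ccontr)
  assume "\<not> ?thesis"
  then have p: "p \<noteq> 0" "degree p < n" by auto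
  let ?q = "\<lambda>k. Polynomial.smult (2 ^ k) (fall k)"
  have "\<exists>c. p = (\<Sum>i<n. Polynomial.smult (c i) (?q i))"
    using p degree_falling_power by (intro poly_as_combination) auto
  then obtain c where c: "p = (\<Sum>i<n. Polynomial.smult (c i) (?q i))" ..
  have zero: "(\<Sum>i<n. c i * x (n - i) w) = 0" for w
  proof -
    have "alg.ev half_x p = (\<Oplus>\<^bsub>alg\<^esub>i\<in>{..<n}. alg.ev half_x (Polynomial.smult (c i) (?q i)))"
      unfolding c by (rule alg.ev_sum) simp_all
    then have "alg.ev half_x p w = (\<Sum>i<n. alg.ev half_x (Polynomial.smult (c i) (?q i)) w)"
      by (simp add: finsum_apply)
    also have "\<dots> = (\<Sum>i<n. c i * x (n - i) w)"
    proof (rule sum.cong[OF refl])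
      fix i assume "i \<in> {..<n}"
      then have "alg.ev half_x (?q i) = x (n - i)" by (intro ev_fall) auto
      then show "alg.ev half_x (Polynomial.smult (c i) (?q i)) w = c i * x (n - i) w"
        unfolding alg.ev_smult[OF half_x_closed, of "c i"] by simp
    qed
    finally show ?thesis using assms by simp
  qed
  have tail: "(\<Sum>i\<in>{d..<n}. c i) = 0" if "d \<le> n" for d
  proof (cases "d < n")
    case True
    then obtain w where w: "\<forall>i<n. x (n - i) w = (if d \<le> i then 1 else 0)"
      by (rule separating_element)
    have "(\<Sum>i<n. c i * x (n - i) w) = (\<Sum>i<n. if d \<le> i then c i else 0)"
      using w by (intro sum.cong) auto
    also have "\<dots> = (\<Sum>i\<in>{d..<n}. c i)"
      by (simp add: sum.If_cases Int_def atLeastLessThan_def lessThan_def atLeast_def conj_commute)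
    finally show ?thesis using zero by simp
  qed simp
  have "c d = 0" if "d < n" for d
    using tail[of d] tail[of "Suc d"] that by (simp add: sum.atLeast_Suc_lessThan)
  then have "p = 0" unfolding c by simp
  then show False using p by simp
qed

text \<open>Evaluation does not see multiples of \<open>rel\<close>, and by \<open>ev_inj\<close> a
  remainder modulo \<open>rel\<close> in the kernel must be zero.\<close>

lemma D_ideal_eq: "D_ideal n = {p. alg.ev half_x p = \<zero>\<^bsub>alg\<^esub>}"
proof -
  have "D_ideal n = {r * rel |r. True}"
    by (simp add: D_ideal_def cgenideal_def rel_def)
  also have "\<dots> = {p. alg.ev half_x p = \<zero>\<^bsub>alg\<^esub>}"
  proof (intro subset_antisym subsetI)
    fix p assume "p \<in> {p. alg.ev half_x p = \<zero>\<^bsub>alg\<^esub>}"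
    moreover have p: "p = p div rel * rel + p mod rel" by simp
    then have "alg.ev half_x p = alg.ev half_x (p mod rel)"
      using alg.ev_add[OF half_x_closed, of "p div rel * rel" "p mod rel"] ev_rel by simp
    ultimately have "p mod rel = 0"
      using ev_inj[of "p mod rel"] degree_mod_less[OF rel_degree(1), of p] rel_degree(2) by auto
    then show "p \<in> {r * rel |r. True}" using p by (metis (mono_tags, lifting) add_0_right mem_Collect_eq)
  qed (auto simp: ev_rel)
  finally show ?thesis .
qed

lemma E_algebra_eq: "E_algebra W S s n = generated_subalgebra alg {2 \<odot>\<^bsub>alg\<^esub> half_x}"
  by (simp add: E_algebra_def smult_2_half_x)

lemma ev_power_x: "alg.ev half_x ([:0, 2:] ^ m) = x (n - 1) [^]\<^bsub>alg\<^esub> m"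
  by (simp add: alg.ev_power ev_linear)

lemma basis_x:
  "basis_in alg (carrier (E_algebra W S s n)) (map x [1..<n + 1])"
proof -
  \<comment> \<open>Entry \<open>i\<close> of the list is \<open>x (i + 1)\<close>, which is a
    polynomial of degree \<open>n - 1 - i\<close> in \<open>half_x\<close>, so the degrees run
    backwards.\<close>
  have f: "bij_betw (\<lambda>i. n - 1 - i) {..<n} {..<n}"
    by (rule bij_betw_byWitness[where f' = "\<lambda>i. n - 1 - i"]) auto
  have "map x [1..<n + 1] =
      map (\<lambda>i. alg.ev half_x (Polynomial.smult (2 ^ (n - 1 - i)) (fall (n - 1 - i)))) [0..<n]"
  proof (rule nth_equalityI)
    fix i assume "i < length (map x [1..<n + 1])"
    then show "map x [1..<n + 1] ! i =
        map (\<lambda>i. alg.ev half_x (Polynomial.smult (2 ^ (n - 1 - i)) (fall (n - 1 - i)))) [0..<n] ! i"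
      using ev_fall[of "n - 1 - i"] by (simp del: upt_Suc)
  qed simp
  then show ?thesis unfolding E_algebra_eq
    using alg.basis_ev[OF half_x_closed _ ev_inj ev_rel rel_degree _ f, of 2
        "\<lambda>k. Polynomial.smult (2 ^ k) (fall k)"] degree_falling_power by simp
qed

lemma basis_powers:
  "basis_in alg (carrier (E_algebra W S s n)) (map (\<lambda>m. x (n - 1) [^]\<^bsub>alg\<^esub> m) [0..<n])"
proof -
  have "[:0, 2::rat:] ^ i \<noteq> 0 \<and> degree ([:0, 2::rat:] ^ i) = i" for i
    by (simp add: degree_power_eq)
  then show ?thesis unfolding E_algebra_eq
    using alg.basis_ev[OF half_x_closed _ ev_inj ev_rel rel_degree _ bij_betw_id, of 2 "\<lambda>i. [:0, 2:] ^ i"]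
    by (simp add: ev_power_x id_def)
qed

lemma iso_D_ideal:
  "\<exists>\<phi>\<in>algebra_iso (E_algebra W S s n) (quotient_algebra poly_algebra (D_ideal n)).
    \<phi> (x (n - 1)) = D_ideal n +>\<^bsub>poly_algebra\<^esub> (2 * fall 1)"
proof -
  interpret poly: cring poly_algebra by (rule cring_poly_algebra)
  have "ideal (D_ideal n) poly_algebra"
    unfolding D_ideal_def by (rule poly.cgenideal_ideal) simp
  then obtain \<phi> where "\<phi> \<in> algebra_iso (E_algebra W S s n) (quotient_algebra poly_algebra (D_ideal n))"
      and "\<forall>p. \<phi> (alg.ev half_x p) = D_ideal n +>\<^bsub>poly_algebra\<^esub> p"
    unfolding E_algebra_eq using alg.algebra_iso_quotient[OF half_x_closed, of 2 "D_ideal n"] D_ideal_eq by auto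
  moreover have "2 * fall 1 = [:0, 2:]" by (simp add: falling_power_Suc numeral_poly)
  moreover have "alg.ev half_x [:0, 2:] = x (n - 1)" using ev_linear[of 0] by simp
  ultimately show ?thesis by metis
qed

lemma finite_sum_ev:
  "alg.ev half_x (\<Sum>m\<in>{0..k::nat}. Polynomial.smult (c m) (p m)) =
    (\<Oplus>\<^bsub>alg\<^esub>m\<in>{0..k}. c m \<odot>\<^bsub>alg\<^esub> alg.ev half_x (p m))"
  by (simp add: alg.ev_sum)

text \<open>The Stirling identity for polynomials, evaluated at \<open>half_x\<close>: there
  \<open>[:0, 2:]\<close> becomes \<open>x (n - 1)\<close> and the scaled falling power becomes
  \<open>x (n - k)\<close>. The inverse formula below arises in the same way.\<close>

lemma x_eq_sum_powers:
  assumes "k \<le> n - 1"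
  shows "x (n - k) = (\<Oplus>\<^bsub>alg\<^esub>m\<in>{0..k}.
    ((-2) ^ (k - m) * of_nat (stirling k m)) \<odot>\<^bsub>alg\<^esub> (x (n - 1) [^]\<^bsub>alg\<^esub> m))"
proof -
  have "Polynomial.smult (2 ^ k) (fall k) =
      (\<Sum>m\<in>{0..k}. Polynomial.smult ((-2) ^ (k - m) * of_nat (stirling k m)) ([:0, 2:] ^ m))"
    using falling_power_stirling[of k "[:0, 1::rat:]"] by (simp only: poly_coeff_eqs)
  then show ?thesis using ev_fall[OF assms] finite_sum_ev[of _ "\<lambda>m. [:0, 2:] ^ m" k]
    by (simp add: ev_power_x)
qed

lemma power_eq_sum_x:
  assumes "k \<le> n - 1"
  shows "x (n - 1) [^]\<^bsub>alg\<^esub> k = (\<Oplus>\<^bsub>alg\<^esub>m\<in>{0..k}.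
    (of_nat (Stirling k m) * 2 ^ (k - m)) \<odot>\<^bsub>alg\<^esub> x (n - m))"
proof -
  have "[:0, 2:] ^ k = (\<Sum>m\<in>{0..k}. Polynomial.smult (of_nat (Stirling k m) * 2 ^ (k - m))
      (Polynomial.smult (2 ^ m) (fall m)))"
    using power_Stirling[of "[:0, 1::rat:]" k] by (simp only: poly_coeff_eqs)
  then have "x (n - 1) [^]\<^bsub>alg\<^esub> k = (\<Oplus>\<^bsub>alg\<^esub>m\<in>{0..k}. (of_nat (Stirling k m) * 2 ^ (k - m))
      \<odot>\<^bsub>alg\<^esub> alg.ev half_x (Polynomial.smult (2 ^ m) (fall m)))"
    unfolding ev_power_x[symmetric] by (simp only: finite_sum_ev)
  also have "\<dots> = (\<Oplus>\<^bsub>alg\<^esub>m\<in>{0..k}. (of_nat (Stirling k m) * 2 ^ (k - m)) \<odot>\<^bsub>alg\<^esub> x (n - m))"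
    \<comment> \<open>The rule \<open>alg.ev_smult\<close> would pull the factor
      \<open>2 ^ m\<close> out and hide the left side of \<open>ev_fall\<close>.\<close>
    by (rule alg.finsum_cong') (use assms in \<open>auto simp: ev_fall simp del: alg.ev_smult\<close>)
  finally show ?thesis .
qed

end

theorem proposition3p10:
  fixes W :: "('w, 'm) monoid_scheme" and S :: "'w set" and s :: "nat \<Rightarrow> 'w" and n :: nat
  assumes "n \<ge> 3"
    and "coxeter_system_type_D W S s n"
  shows
    "(\<exists>\<phi> \<in> algebra_iso (E_algebra W S s n) (quotient_algebra poly_algebra (D_ideal n)).
        \<phi> (x_elem W S s (n - 1)) =
          D_ideal n +>\<^bsub>poly_algebra\<^esub> (2 * falling_power [:0, 1:] 1)) \<and>
     basis_in (group_algebra W) (carrier (E_algebra W S s n))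
       (map (x_elem W S s) [1..<n + 1]) \<and>
     basis_in (group_algebra W) (carrier (E_algebra W S s n))
       (map (\<lambda>m. x_elem W S s (n - 1) [^]\<^bsub>group_algebra W\<^esub> m) [0..<n]) \<and>
     (\<forall>k \<le> n - 1.
        x_elem W S s (n - k) =
          (\<Oplus>\<^bsub>group_algebra W\<^esub> m\<in>{0..k}.
             ((-2) ^ (k - m) * of_nat (stirling k m)) \<odot>\<^bsub>group_algebra W\<^esub>
               (x_elem W S s (n - 1) [^]\<^bsub>group_algebra W\<^esub> m)) \<and>
        x_elem W S s (n - 1) [^]\<^bsub>group_algebra W\<^esub> k =
          (\<Oplus>\<^bsub>group_algebra W\<^esub> m\<in>{0..k}.
             (of_nat (Stirling k m) * 2 ^ (k - m)) \<odot>\<^bsub>group_algebra W\<^esub>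
               x_elem W S s (n - m)))"
proof -
  interpret coxeter_D W S s n using assms by unfold_locales
  show ?thesis
    using iso_D_ideal basis_x basis_powers x_eq_sum_powers power_eq_sum_x by blast
qed

end
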